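(* Let $0\le|\beta|<\alpha$, $\mu\in\mathbb{R}$, let $n\ge1$ be an integer, let $X_1,\ldots,X_n$ be independent $\mathrm{AL}(\alpha,\beta,\mu)$ random variables, and let $S=\sum_{i=1}^nX_i$. Put $m=n-1$ and $\lambda=n\mu$, and let $r>-1$. If $\mu\ne0$, then $$\begin{aligned} \mathbb{E}[|S|^r]&=\frac{(1-\beta^2/\alpha^2)^{m+1}}{2^{m+1}m!\,\alpha^r}\sum_{j=0}^{m}\frac{(m+j)!}{(m-j)!\,j!\,2^j}\bigg[\frac{\mathrm{e}^{-\alpha|\lambda|-\beta\lambda}\,\Gamma(r+1)}{(1+\mathrm{sgn}(\lambda)\beta/\alpha)^{r+m-j+1}}\,U(j-m,\,j-m-r,\,\alpha|\lambda|+\beta\lambda)\\ &\quad+(\alpha|\lambda|)^{r+m-j+1}B(r+1,m-j+1)\,M(m-j+1,\,r+m-j+2,\,-\alpha|\lambda|-\beta\lambda)\\ &\quad+(\alpha|\lambda|)^{r+m-j+1}(m-j)!\;U(m-j+1,\,r+m-j+2,\,\alpha|\lambda|-\beta\lambda)\bigg], \end{aligned}$$ and if $\mu=0$, then $$\mathbb{E}[|S|^r]=\frac{(1-\beta^2/\alpha^2)^{m+1}}{2^{m+1}m!\,\alpha^r}\sum_{j=0}^{m}\frac{(m+j)!}{(m-j)!\,j!\,2^j}\bigg[\frac{\Gamma(r+1)}{(1+\beta/\alpha)^{r+m-j+1}}+\frac{\Gamma(r+1)}{(1-\beta/\alpha)^{r+m-j+1}}\bigg].$$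
   Context: $\mathrm{AL}(\alpha,\beta,\mu)$ denotes the asymmetric Laplace distribution, with probability density function $p(x)=\frac{\alpha^2-\beta^2}{2\alpha}\,\mathrm{e}^{\beta(x-\mu)-\alpha|x-\mu|}$, $x\in\mathbb{R}$. $M(a,b,x)={}_1F_1(a;b;x)$ and $U(a,b,x)$ are the confluent hypergeometric functions of the first and second kind (Kummer and Tricomi functions), $B$ is the beta function, and $\mathrm{sgn}$ is the sign function.
   Formalization: In the case μ=0 both numerators Γ(r+1) are corrected to Γ(r+m−j+1); the printed formula fails, e.g. for n=2, α=1, β=0, r=2 it gives 2 while E[S²]=4. *)

theory Defs
  imports "HOL-Probability.Probability" "HOL-Library.Landau_Symbols"
begin

definition AL_density :: "real \<Rightarrow> real \<Rightarrow> real \<Rightarrow> real \<Rightarrow> real" where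
  "AL_density \<alpha> \<beta> \<mu> x =
     (\<alpha>\<^sup>2 - \<beta>\<^sup>2) / (2 * \<alpha>) * exp (\<beta> * (x - \<mu>) - \<alpha> * \<bar>x - \<mu>\<bar>)"

definition kummer_M :: "real \<Rightarrow> real \<Rightarrow> real \<Rightarrow> real" where
  "kummer_M a b x = (\<Sum>k. pochhammer a k / (pochhammer b k * fact k) * x ^ k)"

text \<open>
  Tricomi's function is defined as in the NIST Digital Library of Mathematical Functions
  (Section 13.2): it is the solution of Kummer's equation
  \<open>x f'' + (b - x) f' - a f = 0\<close> with \<open>f x \<sim> x powr (- a)\<close> as \<open>x \<rightarrow> \<infinity>\<close>. For all real
  \<open>a\<close> and \<open>b\<close> this condition singles out one solution on the positive half-line, because
  every solution that is not a multiple of it grows like \<open>exp x * x powr (a - b)\<close>.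
  The definition covers integer \<open>b\<close> and nonpositive integer \<open>a\<close>, and is meaningful for
  \<open>x > 0\<close> only.
\<close>

definition is_tricomi_solution :: "real \<Rightarrow> real \<Rightarrow> (real \<Rightarrow> real) \<Rightarrow> bool" where
  "is_tricomi_solution a b f \<longleftrightarrow>
     (\<exists>f' f''. \<forall>x>0. (f has_real_derivative f' x) (at x) \<and>
                     (f' has_real_derivative f'' x) (at x) \<and>
                     x * f'' x + (b - x) * f' x - a * f x = 0) \<and>
     f \<sim>[at_top] (\<lambda>x. x powr (- a))"

definition tricomi_U :: "real \<Rightarrow> real \<Rightarrow> real \<Rightarrow> real" where
  "tricomi_U a b x = (THE y. \<exists>f. is_tricomi_solution a b f \<and> y = f x)"

text \<open>
  Erratum to the source: for \<open>\<mu> = 0\<close> the source prints \<open>\<Gamma>(r + 1)\<close> in both numerators,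
  where the theorem has \<open>\<Gamma>(r + m - j + 1)\<close>. The printed formula is false: for \<open>n = 2\<close>,
  \<open>\<alpha> = 1\<close>, \<open>\<beta> = 0\<close>, \<open>r = 2\<close> it gives 2, while the second moment of the sum of two
  independent standard Laplace variables is 4. The corrected formula is the limit of the
  formula for \<open>\<mu> \<noteq> 0\<close> as \<open>\<mu> \<rightarrow> 0\<close>; the two agree for \<open>n = 1\<close>.
\<close>

end

theory Submission
  imports Defs "HOL-Real_Asymp.Real_Asymp" "HOL-Computational_Algebra.Polynomial"
begin

text \<open>
  Exponential tilting and translation commute with convolution, so the density of \<open>S\<close> is a tilted
  and translated convolution power of the symmetric Laplace density. That power has the form
  \<open>exp (- \<bar>t\<bar>) * P\<^sub>m \<bar>t\<bar>\<close> with explicit polynomials \<open>P\<^sub>m\<close>; this follows by induction because convolution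
  with \<open>exp (- \<bar>t\<bar>) / 2\<close> inverts \<open>Q \<mapsto> Q - Q''\<close>. Integrating \<open>\<bar>x\<bar> powr r\<close> against one monomial of the
  density over the three intervals cut out by \<open>0\<close> and \<open>\<lambda>\<close> gives, after rescaling by \<open>\<bar>\<lambda>\<bar>\<close>, one Euler
  integral of \<open>M\<close> and two Laplace-type integrals of \<open>U\<close>, one of which is rewritten by
  \<open>U(a, b, z) = z powr (1 - b) * U(a - b + 1, 2 - b, z)\<close>.
  The integrals are matched with \<open>U\<close> by checking Kummer's equation and the asymptotics at infinity.
\<close>

text \<open>\<open>tricomi_U\<close> is a definite description, so nothing can be said about its
  values until a concrete solution is exhibited and shown to be the only one. Every \<open>U\<close>
  in the result is therefore reached through an explicit positive integral. That integral converges
  only for a positive first parameter, while the formula contains \<open>U\<close> with first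
  parameter \<open>j - m\<close>, a nonpositive integer; this is the reason for the transformation,
  which shifts the first parameter. The polynomials are the reverse Bessel polynomials divided by
  \<open>2 ^ (m + 1) * fact m\<close>: a convolution power of the Laplace density is a multiple of
  \<open>\<bar>t\<bar> powr (m + 1/2)\<close> times the Bessel function K of order
  \<open>m + 1/2\<close>. No Bessel theory enters; the explicit coefficients are checked against the
  recurrence that inverts the convolution, together with one condition at 0 that removes the kink of
  \<open>\<bar>t\<bar>\<close>. Convolution of densities is expressed by nonnegative integrals, so
  the halves into which a convolution is cut must each be shown to be nonnegative before they are
  added.\<close>

subsection \<open>Tricomi's function\<close>

text \<open>
  The Wronskian of \<open>F\<close> and \<open>G\<close> is a multiple of \<open>x powr (- b) * exp x\<close>. A nonzero multiple would make
  \<open>(G / F)'\<close> unbounded, although \<open>G / F\<close> tends to \<open>1\<close>. Positivity of \<open>F\<close> lets the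
  quotient be used on the whole half-line.
\<close>

lemma tricomi_solution_unique:
  assumes F: "is_tricomi_solution a b F" and pos: "\<And>x. x > 0 \<Longrightarrow> F x > 0"
    and G: "is_tricomi_solution a b G" and x: "x > 0"
  shows "G x = F x"
proof -
  obtain F' F'' where
    F1: "\<And>x. x > 0 \<Longrightarrow> (F has_real_derivative F' x) (at x)" and
    F2: "\<And>x. x > 0 \<Longrightarrow> (F' has_real_derivative F'' x) (at x)" and
    FE: "\<And>x. x > 0 \<Longrightarrow> x * F'' x + (b - x) * F' x - a * F x = 0" and
    Fa: "F \<sim>[at_top] (\<lambda>x. x powr (- a))"
    using F unfolding is_tricomi_solution_def by blast
  obtain G' G'' where
    G1: "\<And>x. x > 0 \<Longrightarrow> (G has_real_derivative G' x) (at x)" and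
    G2: "\<And>x. x > 0 \<Longrightarrow> (G' has_real_derivative G'' x) (at x)" and
    GE: "\<And>x. x > 0 \<Longrightarrow> x * G'' x + (b - x) * G' x - a * G x = 0" and
    Ga: "G \<sim>[at_top] (\<lambda>x. x powr (- a))"
    using G unfolding is_tricomi_solution_def by blast
  define W where "W = (\<lambda>x. F x * G' x - F' x * G x)"
  have WE: "x * (F x * G'' x - F'' x * G x) = (x - b) * W x" if "x > 0" for x
  proof -
    have "x * (F x * G'' x - F'' x * G x) = F x * (x * G'' x) - G x * (x * F'' x)"
      by (simp add: algebra_simps)
    also have "x * G'' x = a * G x - (b - x) * G' x" using GE[OF that] by simp
    also have "x * F'' x = a * F x - (b - x) * F' x" using FE[OF that] by simp
    finally show ?thesis by (simp add: W_def algebra_simps)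
  qed
  \<comment> \<open>Abel's identity: by \<open>WE\<close> the Wronskian satisfies
    \<open>x * W' = (x - b) * W\<close>, whose integrating factor is
    \<open>x powr b * exp (- x)\<close>.\<close>
  have "((\<lambda>x. W x * x powr b * exp (- x)) has_real_derivative 0) (at x)" if "x > 0" for x
  proof -
    have "((\<lambda>x. W x * x powr b * exp (- x)) has_real_derivative
        (F x * G'' x - F'' x * G x) * x powr b * exp (- x)
        + W x * (b * x powr (b - 1)) * exp (- x) - W x * x powr b * exp (- x)) (at x)"
      unfolding W_def
      by (rule derivative_eq_intros F1 F2 G1 G2 that refl | simp add: that)+
        (simp add: algebra_simps)
    also have "(F x * G'' x - F'' x * G x) * x powr b * exp (- x)
        + W x * (b * x powr (b - 1)) * exp (- x) - W x * x powr b * exp (- x)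
      = x powr (b - 1) * exp (- x) * (x * (F x * G'' x - F'' x * G x) + b * W x - x * W x)"
      using that by (simp add: powr_diff field_simps)
    also have "\<dots> = 0" unfolding WE[OF that] by (simp add: algebra_simps)
    finally show ?thesis .
  qed
  hence "\<exists>C. \<forall>x\<in>{0<..}. W x * x powr b * exp (- x) = C"
    by (intro has_field_derivative_zero_constant)
      (auto intro: has_field_derivative_at_within)
  then obtain C where C: "\<And>x. x > 0 \<Longrightarrow> W x * x powr b * exp (- x) = C" by auto
  define Q where "Q = (\<lambda>x. G x / F x)"
  have Q': "(Q has_real_derivative W x / (F x)\<^sup>2) (at x)" if "x > 0" for x
    unfolding Q_def W_def using pos[OF that]
    by (auto intro!: derivative_eq_intros F1 G1 that simp: power2_eq_square field_simps)
  have Qlim: "(Q \<longlongrightarrow> 1) at_top"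
  proof -
    have "G \<sim>[at_top] F"
      using asymp_equiv_trans[OF Ga asymp_equiv_symI[OF Fa]] .
    \<comment> \<open>Asymptotic equivalence treats 0/0 as 1; positivity of \<open>F\<close> makes
      that branch vacuous on the positive half-line.\<close>
    hence "((\<lambda>x. if G x = 0 \<and> F x = 0 then 1 else G x / F x) \<longlongrightarrow> 1) at_top"
      by (simp add: asymp_equiv_def)
    thus ?thesis
      by (rule Lim_transform_eventually)
        (use eventually_gt_at_top[of 0] in eventually_elim, use pos in \<open>force simp: Q_def\<close>)
  qed
  have "C = 0"
  proof (rule ccontr)
    assume "C \<noteq> 0"
    have "(\<lambda>x. x powr b * exp (- x) * (F x * F x))
        \<sim>[at_top] (\<lambda>x. x powr b * exp (- x) * (x powr (- a) * x powr (- a)))"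
      by (intro asymp_equiv_intros Fa)
    moreover have "((\<lambda>x. x powr b * exp (- x) * (x powr (- a) * x powr (- a))) \<longlongrightarrow> 0) at_top"
      by real_asymp
    ultimately have "((\<lambda>x. x powr b * exp (- x) * (F x * F x)) \<longlongrightarrow> 0) at_top"
      using asymp_equiv_symI tendsto_asymp_equiv_cong by blast
    hence ev1: "eventually (\<lambda>x. \<bar>x powr b * exp (- x) * (F x * F x)\<bar> < \<bar>C\<bar>) at_top"
      using \<open>C \<noteq> 0\<close> by (auto simp: tendsto_iff dist_real_def)
    \<comment> \<open>With both values of \<open>Q\<close> within 1/2 of 1, the mean value theorem
      on an interval of length 1 yields a point where the derivative is below 1 in absolute value.
      There \<open>ev1\<close> makes the same derivative,
      \<open>C / (x powr b * exp (- x) * (F x * F x))\<close>, larger than 1.\<close>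
    have ev2: "eventually (\<lambda>x. \<bar>Q x - 1\<bar> < 1/2) at_top"
      using tendstoD[OF Qlim, of "1/2"] by (simp only: dist_real_def)
    obtain X where X: "\<And>x. x \<ge> X \<Longrightarrow> \<bar>x powr b * exp (- x) * (F x * F x)\<bar> < \<bar>C\<bar>"
      "\<And>x. x \<ge> X \<Longrightarrow> \<bar>Q x - 1\<bar> < 1/2" 
      using ev1 ev2 eventually_conj[OF ev1 ev2] unfolding eventually_at_top_linorder by blast
    define y where "y = max X 1"
    have y: "y > 0" "y \<ge> X" by (auto simp: y_def)
    obtain z where z: "z > y" "z < y + 1" "Q (y + 1) - Q y = (y + 1 - y) * (W z / (F z)\<^sup>2)"
      using MVT2[of y "y + 1" Q "\<lambda>x. W x / (F x)\<^sup>2"] Q' y(1) by force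
    have z0: "z > 0" using z y by simp
    have "\<bar>Q (y + 1) - Q y\<bar> < 1"
      using X(2)[of y] X(2)[of "y + 1"] y by linarith
    hence "\<bar>W z / (F z)\<^sup>2\<bar> < 1" using z by simp
    hence "\<bar>W z\<bar> < F z * F z" using pos[OF z0] by (simp add: power2_eq_square field_simps abs_mult)
    hence "\<bar>W z\<bar> * (z powr b * exp (- z)) < F z * F z * (z powr b * exp (- z))"
      using z0 by (intro mult_strict_right_mono) auto
    also have "\<dots> < \<bar>C\<bar>" using X(1)[of z] z y by (simp add: abs_mult mult_ac)
    also have "\<bar>C\<bar> = \<bar>W z\<bar> * (z powr b * exp (- z))"
      using C[OF z0] by (auto simp: abs_mult mult_ac)
    finally show False by simp
  qed
  hence W0: "W x = 0" if "x > 0" for x using C[OF that] that by simp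
  have "(Q has_real_derivative 0) (at x within {0<..})" if "x \<in> {0<..}" for x
    using has_field_derivative_at_within[OF Q'[of x]] W0[of x] that by simp
  hence "\<exists>D. \<forall>x\<in>{0<..}. Q x = D"
    by (intro has_field_derivative_zero_constant) auto
  then obtain D where D: "\<And>x. x > 0 \<Longrightarrow> Q x = D" by auto
  have "(Q \<longlongrightarrow> D) at_top"
    by (rule tendsto_eventually) (use eventually_gt_at_top[of 0] in eventually_elim, use D in auto)
  hence "D = 1" using tendsto_unique[OF _ _ Qlim] by simp
  with D[OF x] pos[OF x] show ?thesis by (simp add: Q_def)
qed

text \<open>One positive solution settles both halves of the definite description: it witnesses
  existence, and every competitor agrees with it on the positive half-line.\<close>

lemma tricomi_U_eqI:
  assumes "is_tricomi_solution a b F" "\<And>x. x > 0 \<Longrightarrow> F x > 0" "x > 0"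
  shows "tricomi_U a b x = F x"
  unfolding tricomi_U_def
  using assms by (intro the_equality) (auto intro: tricomi_solution_unique)

text \<open>Multiplication by \<open>x powr (b - 1)\<close> carries one Kummer equation into another
  and also turns the prescribed decay into the prescribed decay for the new parameters. Solutions
  with nonpositive first parameter are obtained in this way from Laplace-type integrals.\<close>

lemma is_tricomi_solution_kummer_transformation:
  assumes "is_tricomi_solution a b f"
  shows "is_tricomi_solution (a - b + 1) (2 - b) (\<lambda>x. x powr (b - 1) * f x)"
proof -
  obtain f' f'' where
    f1: "\<And>x. x > 0 \<Longrightarrow> (f has_real_derivative f' x) (at x)" and
    f2: "\<And>x. x > 0 \<Longrightarrow> (f' has_real_derivative f'' x) (at x)" and
    fE: "\<And>x. x > 0 \<Longrightarrow> x * f'' x + (b - x) * f' x - a * f x = 0" and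
    fa: "f \<sim>[at_top] (\<lambda>x. x powr (- a))"
    using assms unfolding is_tricomi_solution_def by blast
  define g' where "g' = (\<lambda>x. x powr (b - 1) * f' x + (b - 1) * x powr (b - 2) * f x)"
  define g'' where "g'' = (\<lambda>x. x powr (b - 1) * f'' x + 2 * (b - 1) * x powr (b - 2) * f' x
      + (b - 1) * (b - 2) * x powr (b - 3) * f x)"
  have "((\<lambda>x. x powr (b - 1) * f x) has_real_derivative g' x) (at x)" if "x > 0" for x
    unfolding g'_def using that
    by (auto intro!: derivative_eq_intros f1 simp: field_simps)
  moreover have "(g' has_real_derivative g'' x) (at x)" if "x > 0" for x
    unfolding g'_def g''_def using that
    by (auto intro!: derivative_eq_intros f1 f2 simp: algebra_simps)
  moreover have "x * g'' x + ((2 - b) - x) * g' x - (a - b + 1) * (x powr (b - 1) * f x) = 0"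
    if "x > 0" for x
  proof -
    \<comment> \<open>All powers are expressed through the lowest one, so that what remains is a
      polynomial identity in \<open>x\<close>, \<open>f x\<close>, \<open>f' x\<close> and
      \<open>f'' x\<close>.\<close>
    have "x powr (b - 1) = x powr (b - 3) * x\<^sup>2" "x powr (b - 2) = x powr (b - 3) * x"
      using that powr_add[of x "b - 3" 2] powr_add[of x "b - 3" 1] by (auto simp: powr_numeral)
    hence "x * g'' x + ((2 - b) - x) * g' x - (a - b + 1) * (x powr (b - 1) * f x)
      = x powr (b - 3) * x\<^sup>2 * (x * f'' x + (b - x) * f' x - a * f x)"
      unfolding g'_def g''_def by (simp add: algebra_simps power2_eq_square)
    thus ?thesis using fE[OF that] by simp
  qed
  moreover have "(\<lambda>x. x powr (b - 1) * f x) \<sim>[at_top] (\<lambda>x. x powr (- (a - b + 1)))"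
  proof -
    have "(\<lambda>x. x powr (b - 1) * f x) \<sim>[at_top] (\<lambda>x. x powr (b - 1) * x powr (- a))"
      by (intro asymp_equiv_intros fa)
    thus ?thesis by (simp add: powr_add [symmetric] algebra_simps)
  qed
  ultimately show ?thesis unfolding is_tricomi_solution_def by blast
qed

section \<open>Laplace-type integrals for \<open>U\<close>\<close>

lemma has_bochner_integral_Gamma:
  fixes p c :: real
  assumes p: "p > -1" and c: "c > 0"
  shows "has_bochner_integral lborel
    (\<lambda>s. indicator {0<..} s * (s powr p * exp (- (c * s)))) (Gamma (p + 1) / c powr (p + 1))"
proof -
  have "has_bochner_integral lborel (\<lambda>s. indicator {0<..} s * (s powr p * exp (- s))) (Gamma (p + 1))"
  proof (rule has_bochner_integral_nn_integral)
    have "ennreal (Gamma (p + 1)) = (\<integral>\<^sup>+t. ennreal (indicator {0..} t * t powr p / exp t) \<partial>lborel)"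
      using Gamma_conv_nn_integral_real[of "p + 1"] p by simp
    also have "\<dots> = (\<integral>\<^sup>+s. ennreal (indicator {0<..} s * (s powr p * exp (- s))) \<partial>lborel)"
      by (intro nn_integral_cong) (auto simp: indicator_def exp_minus field_simps)
    finally show "(\<integral>\<^sup>+s. ennreal (indicator {0<..} s * (s powr p * exp (- s))) \<partial>lborel)
      = ennreal (Gamma (p + 1))" ..
  qed (use p in \<open>auto intro: less_imp_le Gamma_real_pos\<close>)
  hence "has_bochner_integral lborel (\<lambda>s. indicator {0<..} (0 + c * s) *
      ((0 + c * s) powr p * exp (- (0 + c * s)))) (Gamma (p + 1) /\<^sub>R \<bar>c\<bar>)"
    using c by (subst (asm) lborel_has_bochner_integral_real_affine_iff[of c _ _ 0]) auto
  from has_bochner_integral_mult_right[OF this, of "c powr (- p)"]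
  have "has_bochner_integral lborel (\<lambda>s. c powr (- p) * (indicator {0<..} (0 + c * s) *
      ((0 + c * s) powr p * exp (- (0 + c * s))))) (c powr (- p) * (Gamma (p + 1) /\<^sub>R \<bar>c\<bar>))"
    by simp
  also have "(\<lambda>s. c powr (- p) * (indicator {0<..} (0 + c * s) *
      ((0 + c * s) powr p * exp (- (0 + c * s))))) = (\<lambda>s. indicator {0<..} s * (s powr p * exp (- (c * s))))"
    using c by (auto simp: fun_eq_iff indicator_def powr_mult powr_minus field_simps zero_less_mult_iff)
  also have "c powr (- p) * (Gamma (p + 1) /\<^sub>R \<bar>c\<bar>) = Gamma (p + 1) / c powr (p + 1)"
    using c by (simp add: powr_add powr_minus field_simps)
  finally show ?thesis .
qed

text \<open>The integrand of the classical representation of \<open>Gamma a * U(a, b, x)\<close>,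
  with \<open>p = a - 1\<close> and \<open>q = b - a - 1\<close>. In these exponents,
  differentiation in \<open>x\<close> just raises \<open>p\<close> by one and changes the
  sign.\<close>

definition euler_kernel :: "real \<Rightarrow> real \<Rightarrow> real \<Rightarrow> real \<Rightarrow> real" where
  "euler_kernel p q x s = indicator {0<..} s * (s powr p * (1 + s) powr q * exp (- (x * s)))"

definition euler_integral :: "real \<Rightarrow> real \<Rightarrow> real \<Rightarrow> real" where
  "euler_integral p q x = (\<integral>s. euler_kernel p q x s \<partial>lborel)"

lemma euler_kernel_nonneg: "euler_kernel p q x s \<ge> 0"
  by (simp add: euler_kernel_def)

lemma euler_kernel_measurable [measurable]: "euler_kernel p q x \<in> borel_measurable borel"
  unfolding euler_kernel_def by measurable

text \<open>Since \<open>1 + s \<le> 2 * max 1 s\<close>, the factor is bounded by a sum of two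
  powers of \<open>s\<close>, and the kernel by two Gamma integrands. The absolute value covers both
  signs of \<open>q\<close>.\<close>

lemma one_plus_powr_le:
  fixes s q :: real
  assumes "s \<ge> 0"
  shows "(1 + s) powr q \<le> 2 powr \<bar>q\<bar> * (1 + s powr \<bar>q\<bar>)"
proof -
  have "(1 + s) powr q \<le> (1 + s) powr \<bar>q\<bar>" using assms by (intro powr_mono) auto
  also have "\<dots> \<le> (2 * max 1 s) powr \<bar>q\<bar>" using assms by (intro powr_mono2) auto
  also have "\<dots> = 2 powr \<bar>q\<bar> * (max 1 s) powr \<bar>q\<bar>" using assms by (simp add: powr_mult)
  also have "\<dots> \<le> 2 powr \<bar>q\<bar> * (1 + s powr \<bar>q\<bar>)"
    by (intro mult_left_mono) (auto simp: max_def)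
  finally show ?thesis .
qed

lemma integrable_euler_kernel:
  assumes p: "p > -1" and x: "x > 0"
  shows "integrable lborel (euler_kernel p q x)"
proof (rule Bochner_Integration.integrable_bound)
  show "integrable lborel (\<lambda>s. 2 powr \<bar>q\<bar> * (indicator {0<..} s * (s powr p * exp (- (x * s)))
      + indicator {0<..} s * (s powr (p + \<bar>q\<bar>) * exp (- (x * s)))))"
    using has_bochner_integral_Gamma[of p x] has_bochner_integral_Gamma[of "p + \<bar>q\<bar>" x] p x
    by (intro Bochner_Integration.integrable_add integrable_mult_right)
      (auto simp: has_bochner_integral_iff)
  show "AE s in lborel. norm (euler_kernel p q x s) \<le> norm (2 powr \<bar>q\<bar> *
    (indicator {0<..} s * (s powr p * exp (- (x * s)))
      + indicator {0<..} s * (s powr (p + \<bar>q\<bar>) * exp (- (x * s)))))"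
  proof (rule AE_I2)
    fix s
    show "norm (euler_kernel p q x s) \<le> norm (2 powr \<bar>q\<bar> *
      (indicator {0<..} s * (s powr p * exp (- (x * s)))
      + indicator {0<..} s * (s powr (p + \<bar>q\<bar>) * exp (- (x * s)))))"
    proof (cases "s > 0")
      case True
      have "s powr p * exp (- (x * s)) * (1 + s) powr q
          \<le> s powr p * exp (- (x * s)) * (2 powr \<bar>q\<bar> * (1 + s powr \<bar>q\<bar>))"
        using True by (intro mult_left_mono one_plus_powr_le) auto
      thus ?thesis using True by (simp add: euler_kernel_def powr_add algebra_simps)
    qed (simp add: euler_kernel_def)
  qed
qed measurable

lemma integral_pos_lborel:
  fixes f :: "real \<Rightarrow> real"
  assumes int: "integrable lborel f" and nn: "\<And>s. f s \<ge> 0" and pos: "\<And>s. s > 0 \<Longrightarrow> f s > 0"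
  shows "integral\<^sup>L lborel f > 0"
proof -
  have "\<not> (AE s in lborel. f s = 0)"
  proof
    assume "AE s in lborel. f s = 0"
    hence "AE s in lborel. s \<notin> {0<..<(1::real)}"
      by eventually_elim (use pos in force)
    hence "emeasure lborel {0<..<1::real} = 0"
      by (subst (asm) AE_iff_measurable[of "{0<..<1}"]) auto
    thus False using emeasure_lborel_Ioo[of 0 1] by simp
  qed
  hence "integral\<^sup>L lborel f \<noteq> 0"
    using integral_nonneg_eq_0_iff_AE[OF int] nn by auto
  moreover have "integral\<^sup>L lborel f \<ge> 0" by (intro integral_nonneg_AE AE_I2 nn)
  ultimately show ?thesis by simp
qed

lemma euler_integral_pos: "p > -1 \<Longrightarrow> x > 0 \<Longrightarrow> euler_integral p q x > 0"
  unfolding euler_integral_def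
  by (intro integral_pos_lborel integrable_euler_kernel euler_kernel_nonneg)
    (auto simp: euler_kernel_def)

lemma DERIV_euler_kernel:
  "((\<lambda>x. euler_kernel p q x s) has_real_derivative - euler_kernel (p + 1) q x s) (at x)"
  unfolding euler_kernel_def
  by (cases "s > 0") (auto intro!: derivative_eq_intros simp: powr_add)

text \<open>Provides a majorant of the difference quotients that does not depend on
  \<open>y\<close>, for differentiation under the integral sign. It is the mean value inequality:
  the kernel decreases in its parameter, so on the half-line from \<open>x / 2\<close> the
  derivative is largest in size at \<open>x / 2\<close>.\<close>

lemma euler_kernel_diff_bound:
  assumes x: "x > 0" and y: "y \<ge> x / 2"
  shows "\<bar>euler_kernel p q y s - euler_kernel p q x s\<bar> \<le> euler_kernel (p + 1) q (x / 2) s * \<bar>y - x\<bar>"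
proof -
  have "norm (euler_kernel p q y s - euler_kernel p q x s)
      \<le> euler_kernel (p + 1) q (x / 2) s * norm (y - x)"
  proof (rule field_differentiable_bound)
    show "convex {x / 2..}" by simp
    show "((\<lambda>x. euler_kernel p q x s) has_real_derivative - euler_kernel (p + 1) q z s)
        (at z within {x / 2..})" for z
      by (rule has_field_derivative_at_within[OF DERIV_euler_kernel])
    show "norm (- euler_kernel (p + 1) q z s) \<le> euler_kernel (p + 1) q (x / 2) s"
      if "z \<in> {x / 2..}" for z
    proof (cases "s > 0")
      case True
      hence "x / 2 * s \<le> z * s" using that by (intro mult_right_mono) auto
      thus ?thesis using True by (auto simp: euler_kernel_def intro!: mult_left_mono)
    qed (auto simp: euler_kernel_def)
  qed (use x y in auto)
  thus ?thesis by simp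
qed

lemma DERIV_euler_integral:
  assumes p: "p > -1" and x: "x > 0"
  shows "(euler_integral p q has_real_derivative - euler_integral (p + 1) q x) (at x)"
  unfolding DERIV_def tendsto_at_iff_sequentially
proof (intro allI impI)
  fix X :: "nat \<Rightarrow> real" assume X: "\<forall>i. X i \<in> UNIV - {0}" and lim: "X \<longlonglongrightarrow> 0"
  from lim x have "eventually (\<lambda>i. \<bar>X i\<bar> < x / 2) sequentially"
    using tendstoD[OF lim, of "x / 2"] by (simp add: dist_real_def)
  then obtain N where N: "\<And>i. i \<ge> N \<Longrightarrow> \<bar>X i\<bar> < x / 2"
    by (auto simp: eventually_sequentially)
  \<comment> \<open>Dropping the first \<open>N\<close> terms keeps every \<open>x + Y i\<close>
    above \<open>x / 2\<close>, so one majorant serves all indices in dominated convergence.\<close>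
  define Y where "Y = (\<lambda>i. X (i + N))"
  have Y0: "Y i \<noteq> 0" and Yx: "\<bar>Y i\<bar> < x / 2" for i
    using X N[of "i + N"] by (auto simp: Y_def)
  have Ylim: "Y \<longlonglongrightarrow> 0" unfolding Y_def using lim by (rule LIMSEQ_ignore_initial_segment)
  have eq: "(euler_integral p q (x + Y i) - euler_integral p q x) / Y i
    = (\<integral>s. (euler_kernel p q (x + Y i) s - euler_kernel p q x s) / Y i \<partial>lborel)" for i
    unfolding euler_integral_def using p x Yx[of i]
    by (subst Bochner_Integration.integral_diff[symmetric])
      (auto intro!: integrable_euler_kernel)
  have "(\<lambda>i. \<integral>s. (euler_kernel p q (x + Y i) s - euler_kernel p q x s) / Y i \<partial>lborel)
    \<longlonglongrightarrow> (\<integral>s. - euler_kernel (p + 1) q x s \<partial>lborel)"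
  proof (rule integral_dominated_convergence[where w = "euler_kernel (p + 1) q (x / 2)"])
    show "integrable lborel (euler_kernel (p + 1) q (x / 2))"
      using p x by (intro integrable_euler_kernel) auto
    show "AE s in lborel. (\<lambda>i. (euler_kernel p q (x + Y i) s - euler_kernel p q x s) / Y i)
        \<longlonglongrightarrow> - euler_kernel (p + 1) q x s"
    proof (rule AE_I2)
      fix s
      have "((\<lambda>h. (euler_kernel p q (x + h) s - euler_kernel p q x s) / h)
          \<longlongrightarrow> - euler_kernel (p + 1) q x s) (at 0)"
        using DERIV_euler_kernel[of p q s x] by (simp add: DERIV_def)
      thus "(\<lambda>i. (euler_kernel p q (x + Y i) s - euler_kernel p q x s) / Y i)
        \<longlonglongrightarrow> - euler_kernel (p + 1) q x s"
        using Y0 Ylim unfolding tendsto_at_iff_sequentially by (auto simp: comp_def)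
    qed
    show "AE s in lborel. norm ((euler_kernel p q (x + Y i) s - euler_kernel p q x s) / Y i)
        \<le> euler_kernel (p + 1) q (x / 2) s" for i
    proof (rule AE_I2)
      fix s
      show "norm ((euler_kernel p q (x + Y i) s - euler_kernel p q x s) / Y i)
        \<le> euler_kernel (p + 1) q (x / 2) s"
        using euler_kernel_diff_bound[of x "x + Y i" p q s] x Yx[of i] Y0[of i]
        by (auto simp: divide_le_eq)
    qed
  qed auto
  hence "(\<lambda>i. (euler_integral p q (x + Y i) - euler_integral p q x) / Y i)
    \<longlonglongrightarrow> - euler_integral (p + 1) q x"
    by (simp add: eq) (simp add: euler_integral_def)
  thus "((\<lambda>h. (euler_integral p q (x + h) - euler_integral p q x) / h) \<circ> X)
    \<longlonglongrightarrow> - euler_integral (p + 1) q x"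
    unfolding comp_def Y_def by (rule LIMSEQ_offset)
qed

text \<open>This is Kummer's equation in disguise, because the first two derivatives of
  \<open>euler_integral p q\<close> are \<open>- euler_integral (p + 1) q\<close> and
  \<open>euler_integral (p + 2) q\<close>. It results from integrating the derivative of
  \<open>s powr (p + 1) * (1 + s) powr (q + 1) * exp (- (x * s))\<close>, which vanishes at 0
  because \<open>p + 1 > 0\<close> and at infinity because \<open>x > 0\<close>.\<close>

lemma euler_integral_recurrence:
  assumes p: "p > -1" and x: "x > 0"
  shows "x * euler_integral (p + 2) q x = 
    (p + 1) * euler_integral p q x + (p + q + 2 - x) * euler_integral (p + 1) q x"
proof -
  define F where "F = (\<lambda>s. s powr (p + 1) * (1 + s) powr (q + 1) * exp (- (x * s)))"
  define f where "f = (\<lambda>s. (p + 1) * (s powr p * (1 + s) powr q * exp (- (x * s)))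
    + (p + q + 2 - x) * (s powr (p + 1) * (1 + s) powr q * exp (- (x * s)))
    - x * (s powr (p + 2) * (1 + s) powr q * exp (- (x * s))))"
  have ind: "indicator {0<..} s *\<^sub>R f s = (p + 1) * euler_kernel p q x s
      + (p + q + 2 - x) * euler_kernel (p + 1) q x s - x * euler_kernel (p + 2) q x s" for s
    by (simp add: f_def euler_kernel_def indicator_def)
  have einterval: "einterval (ereal 0) \<infinity> = {0<..}" by (auto simp: einterval_def)
  have "(LBINT s=ereal 0..\<infinity>. f s) = 0 - 0"
  proof (rule interval_integral_FTC_integrable)
    show "(F has_vector_derivative f s) (at s)" if "ereal 0 < ereal s" for s
    proof -
      have s: "s > 0" using that by simp
      have *: "s powr (p + 1) = s powr p * s" "s powr (p + 2) = s powr p * s\<^sup>2"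
        "(1 + s) powr (q + 1) = (1 + s) powr q * (1 + s)" 
        using s powr_add[of s p 2] by (auto simp: powr_add)
      have "(F has_real_derivative ((p + 1) * s powr p * (1 + s) powr (q + 1)
        + s powr (p + 1) * ((q + 1) * (1 + s) powr q) - x * (s powr (p + 1) * (1 + s) powr (q + 1)))
          * exp (- (x * s))) (at s)"
        unfolding F_def using s by (auto intro!: derivative_eq_intros simp: algebra_simps)
      also have "((p + 1) * s powr p * (1 + s) powr (q + 1)
        + s powr (p + 1) * ((q + 1) * (1 + s) powr q) - x * (s powr (p + 1) * (1 + s) powr (q + 1)))
          * exp (- (x * s)) = f s"
        unfolding f_def * by (simp add: algebra_simps power2_eq_square)
      finally show ?thesis by (simp add: has_real_derivative_iff_has_vector_derivative)
    qed
    show "isCont f s" if "ereal 0 < ereal s" for s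
      using that unfolding f_def by (auto intro!: continuous_intros)
    show "set_integrable lborel (einterval (ereal 0) \<infinity>) f"
      unfolding set_integrable_def einterval ind using p x
      by (intro Bochner_Integration.integrable_add Bochner_Integration.integrable_diff
          integrable_mult_right integrable_euler_kernel) auto
    have "(F \<longlongrightarrow> 0) (at_right 0)"
    proof -
      have "((\<lambda>s. s powr (p + 1) * (1 + s) powr (q + 1) * exp (- (x * s)))
          \<longlongrightarrow> 0 powr (p + 1) * (1 + 0) powr (q + 1) * exp (- (x * 0))) (at_right 0)"
        using p by (intro tendsto_intros) (auto simp: eventually_at intro!: exI[of _ 1])
      thus ?thesis by (simp add: F_def)
    qed
    thus "((F \<circ> real_of_ereal) \<longlongrightarrow> 0) (at_right (ereal 0))"
      by (simp only: ereal_tendsto_simps)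
    have "(F \<longlongrightarrow> 0) at_top"
      unfolding F_def using x by real_asymp
    thus "((F \<circ> real_of_ereal) \<longlongrightarrow> 0) (at_left \<infinity>)"
      by (simp only: ereal_tendsto_simps)
  qed auto
  hence "(\<integral>s. (p + 1) * euler_kernel p q x s + (p + q + 2 - x) * euler_kernel (p + 1) q x s
      - x * euler_kernel (p + 2) q x s \<partial>lborel) = 0"
    by (simp only: interval_lebesgue_integral_def set_lebesgue_integral_def einterval ind) simp
  thus ?thesis unfolding euler_integral_def using p x
    by (simp add: integrable_euler_kernel)
qed

text \<open>The leading term of Watson's lemma. After the substitution \<open>s = t / x\<close> the
  factor \<open>(1 + t / x) powr q\<close> tends to 1, and for \<open>x \<ge> 1\<close> it is at
  most \<open>(1 + t) powr \<bar>q\<bar>\<close>, which gives the dominating kernel.\<close>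

lemma euler_integral_asymp:
  assumes p: "p > -1"
  shows "((\<lambda>x. x powr (p + 1) * euler_integral p q x) \<longlongrightarrow> Gamma (p + 1)) at_top"
proof -
  define k where "k = (\<lambda>x t. indicator {0<..} t * (t powr p * (1 + t / x) powr q * exp (- t)))"
  have eq: "x powr (p + 1) * euler_integral p q x = (\<integral>t. k x t \<partial>lborel)" if x: "x > 0" for x
  proof -
    have "euler_integral p q x = \<bar>1 / x\<bar> *\<^sub>R (\<integral>t. euler_kernel p q x (0 + 1 / x * t) \<partial>lborel)"
      unfolding euler_integral_def using x by (intro lborel_integral_real_affine) auto
    also have "(\<lambda>t. euler_kernel p q x (0 + 1 / x * t)) = (\<lambda>t. x powr (- p) * k x t)"
      using x by (auto simp: euler_kernel_def k_def indicator_def powr_divide powr_minus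
          fun_eq_iff field_simps zero_less_divide_iff)
    finally show ?thesis using x by (simp add: powr_add powr_minus field_simps)
  qed
  have "((\<lambda>x. \<integral>t. k x t \<partial>lborel) \<longlongrightarrow>
      (\<integral>t. indicator {0<..} t * (t powr p * exp (- (1 * t))) \<partial>lborel)) at_top"
  proof (rule integral_dominated_convergence_at_top[where w = "euler_kernel p \<bar>q\<bar> 1"])
    show "integrable lborel (euler_kernel p \<bar>q\<bar> 1)"
      using p by (intro integrable_euler_kernel) auto
    show "k x \<in> borel_measurable lborel" for x unfolding k_def by measurable
    show "AE t in lborel. ((\<lambda>x. k x t) \<longlongrightarrow> indicator {0<..} t * (t powr p * exp (- (1 * t)))) at_top"
    proof (rule AE_I2)
      fix t :: real
      have "((\<lambda>x. indicator {0<..} t * (t powr p * (1 + t / x) powr q * exp (- t)))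
        \<longlongrightarrow> indicator {0<..} t * (t powr p * (1 + 0) powr q * exp (- t))) at_top"
        by (intro tendsto_intros tendsto_divide_0[OF tendsto_const] filterlim_at_top_imp_at_infinity
            filterlim_ident) auto
      thus "((\<lambda>x. k x t) \<longlongrightarrow> indicator {0<..} t * (t powr p * exp (- (1 * t)))) at_top"
        by (simp add: k_def)
    qed
    show "\<forall>\<^sub>F x in at_top. AE t in lborel. norm (k x t) \<le> euler_kernel p \<bar>q\<bar> 1 t"
      using eventually_ge_at_top[of 1]
    proof eventually_elim
      fix x :: real assume x: "x \<ge> 1"
      show "AE t in lborel. norm (k x t) \<le> euler_kernel p \<bar>q\<bar> 1 t"
      proof (rule AE_I2)
        fix t :: real
        show "norm (k x t) \<le> euler_kernel p \<bar>q\<bar> 1 t"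
        proof (cases "t > 0")
          case True
          hence "t / x \<ge> 0" "t / x \<le> t" using x by (auto simp: field_simps mult_le_cancel_left1)
          hence "(1 + t / x) powr q \<le> (1 + t / x) powr \<bar>q\<bar>"
            "(1 + t / x) powr \<bar>q\<bar> \<le> (1 + t) powr \<bar>q\<bar>"
            by (auto intro!: powr_mono powr_mono2)
          thus ?thesis using True by (auto simp: k_def euler_kernel_def)
        qed (auto simp: k_def euler_kernel_def)
      qed
    qed
  qed auto
  also have "(\<integral>t. indicator {0<..} t * (t powr p * exp (- (1 * t))) \<partial>lborel) = Gamma (p + 1)"
    using has_bochner_integral_Gamma[of p 1] p by (simp add: has_bochner_integral_iff)
  finally show ?thesis
    by (rule Lim_transform_eventually)
      (use eventually_gt_at_top[of 0] in eventually_elim, simp add: eq)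
qed

lemma is_tricomi_solution_euler_integral:
  assumes p: "p > -1"
  shows "is_tricomi_solution (p + 1) (p + q + 2) (\<lambda>x. euler_integral p q x / Gamma (p + 1))"
proof -
  have G: "Gamma (p + 1) > 0" using p by (intro Gamma_real_pos) auto
  have "((\<lambda>x. euler_integral p q x / Gamma (p + 1)) has_real_derivative
       - euler_integral (p + 1) q x / Gamma (p + 1)) (at x)" if "x > 0" for x
    using DERIV_cdivide[OF DERIV_euler_integral[OF p that]] .
  moreover have "((\<lambda>x. - euler_integral (p + 1) q x / Gamma (p + 1)) has_real_derivative
       euler_integral (p + 2) q x / Gamma (p + 1)) (at x)" if "x > 0" for x
    using DERIV_cdivide[OF DERIV_minus[OF DERIV_euler_integral[of "p + 1" x q]]] p that
    by (simp add: add.assoc)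
  moreover have "x * (euler_integral (p + 2) q x / Gamma (p + 1)) 
      + (p + q + 2 - x) * (- euler_integral (p + 1) q x / Gamma (p + 1))
      - (p + 1) * (euler_integral p q x / Gamma (p + 1)) = 0" if "x > 0" for x
  proof -
    have "x * (euler_integral (p + 2) q x / Gamma (p + 1)) 
      + (p + q + 2 - x) * (- euler_integral (p + 1) q x / Gamma (p + 1))
      - (p + 1) * (euler_integral p q x / Gamma (p + 1))
      = (x * euler_integral (p + 2) q x - ((p + 1) * euler_integral p q x
          + (p + q + 2 - x) * euler_integral (p + 1) q x)) / Gamma (p + 1)"
      by (simp add: diff_divide_distrib add_divide_distrib)
    thus ?thesis using euler_integral_recurrence[OF p that, of q] by simp
  qed
  moreover have "(\<lambda>x. euler_integral p q x / Gamma (p + 1)) \<sim>[at_top] (\<lambda>x. x powr (- (p + 1)))"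
  proof (rule asymp_equivI')
    have "((\<lambda>x. x powr (p + 1) * euler_integral p q x / Gamma (p + 1))
        \<longlongrightarrow> Gamma (p + 1) / Gamma (p + 1)) at_top"
      using G by (intro tendsto_intros euler_integral_asymp p) auto
    also have "(\<lambda>x. x powr (p + 1) * euler_integral p q x / Gamma (p + 1))
        = (\<lambda>x. euler_integral p q x / Gamma (p + 1) / x powr (- (p + 1)))"
      by (simp only: powr_minus) (simp add: fun_eq_iff field_simps)
    finally show "((\<lambda>x. euler_integral p q x / Gamma (p + 1) / x powr (- (p + 1))) \<longlongrightarrow> 1) at_top"
      using G by simp
  qed
  ultimately show ?thesis unfolding is_tricomi_solution_def
    by (intro conjI exI[of _ "\<lambda>x. - euler_integral (p + 1) q x / Gamma (p + 1)"]
        exI[of _ "\<lambda>x. euler_integral (p + 2) q x / Gamma (p + 1)"] allI impI) auto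
qed

lemma euler_integral_eq_tricomi_U:
  assumes p: "p > -1" and x: "x > 0"
  shows "euler_integral p q x = Gamma (p + 1) * tricomi_U (p + 1) (p + q + 2) x"
proof -
  have G: "Gamma (p + 1) > 0" using p by (intro Gamma_real_pos) auto
  have "tricomi_U (p + 1) (p + q + 2) x = euler_integral p q x / Gamma (p + 1)"
    by (intro tricomi_U_eqI is_tricomi_solution_euler_integral p x
        divide_pos_pos euler_integral_pos G)
  thus ?thesis using G by simp
qed

text \<open>The same integral read through the Kummer transformation. With \<open>q = real i\<close>
  the first parameter is a nonpositive integer, as needed for the part of the moment on the far side
  of 0.\<close>

lemma euler_integral_eq_tricomi_U':
  assumes p: "p > -1" and x: "x > 0"
  shows "x powr (p + q + 1) * euler_integral p q x = Gamma (p + 1) * tricomi_U (- q) (- q - p) x"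
proof -
  have G: "Gamma (p + 1) > 0" using p by (intro Gamma_real_pos) auto
  have "is_tricomi_solution (- q) (- q - p)
    (\<lambda>x. x powr (p + q + 1) * (euler_integral p q x / Gamma (p + 1)))"
    using is_tricomi_solution_kummer_transformation[OF is_tricomi_solution_euler_integral[OF p, of q]]
    by (simp add: algebra_simps minus_diff_commute[of q p])
  hence "tricomi_U (- q) (- q - p) x = x powr (p + q + 1) * (euler_integral p q x / Gamma (p + 1))"
    using p x G by (intro tricomi_U_eqI) (auto intro!: mult_pos_pos divide_pos_pos euler_integral_pos)
  thus ?thesis using G by simp
qed

subsection \<open>Kummer's function\<close>

lemma has_bochner_integral_Beta:
  fixes a b :: real
  assumes a: "a > 0" and b: "b > 0"
  shows "has_bochner_integral lborel
    (\<lambda>s. indicator {0<..<1} s * (s powr (a - 1) * (1 - s) powr (b - 1))) (Beta a b)"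
proof -
  have 1: "integrable lborel (\<lambda>s. indicator {0..1} s *\<^sub>R (s powr (a - 1) * (1 - s) powr (b - 1)))"
    using integrable_Beta[OF a b] by (simp add: set_integrable_def)
  have "(\<integral>s. indicator {0..1} s *\<^sub>R (s powr (a - 1) * (1 - s) powr (b - 1)) \<partial>lborel) = Beta a b"
    using set_borel_integral_eq_integral(2)[OF integrable_Beta[OF a b]]
      integral_unique[OF has_integral_Beta_real[OF a b]]
    by (simp add: set_lebesgue_integral_def)
  with 1 have "has_bochner_integral lborel
      (\<lambda>s. indicator {0..1} s *\<^sub>R (s powr (a - 1) * (1 - s) powr (b - 1))) (Beta a b)"
    by (simp add: has_bochner_integral_iff)
  \<comment> \<open>Equality holds at every point: \<open>0 powr x = 0\<close> for all
    \<open>x\<close>, so the integrand vanishes at both endpoints.\<close>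
  also have "(\<lambda>s. indicator {0..1} s *\<^sub>R (s powr (a - 1) * (1 - s) powr (b - 1)))
    = (\<lambda>s. indicator {0<..<1} s * (s powr (a - 1) * (1 - s) powr (b - 1)))"
    by (auto simp: indicator_def fun_eq_iff)
  finally show ?thesis .
qed

lemma Beta_add_nat_left:
  fixes a b :: real
  assumes a: "a > 0" and b: "b > 0"
  shows "Beta (a + real i) b = Beta a b * pochhammer a i / pochhammer (a + b) i"
proof -
  have "pochhammer a i = Gamma (a + real i) / Gamma a"
    "pochhammer (a + b) i = Gamma (a + b + real i) / Gamma (a + b)"
    using a b by (auto intro!: pochhammer_Gamma dest: nonpos_Ints_nonpos)
  moreover have "Gamma a > 0" "Gamma (a + b) > 0" "Gamma (a + b + real i) > 0"
    using a b by (auto intro!: Gamma_real_pos)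
  ultimately show ?thesis by (simp add: Beta_def field_simps)
qed

text \<open>The exponential is expanded and integrated term by term; the \<open>i\<close>-th term is
  a Beta integral whose first parameter is raised by \<open>i\<close>. Since
  \<open>0 < s < 1\<close>, the series of \<open>exp \<bar>z\<bar>\<close> controls everything, and
  the interchange also yields convergence of the series for \<open>kummer_M\<close>.\<close>

lemma kummer_M_integral:
  fixes a b z :: real
  assumes a: "a > 0" and b: "b > 0"
  shows "has_bochner_integral lborel
    (\<lambda>s. indicator {0<..<1} s * (s powr (a - 1) * (1 - s) powr (b - 1) * exp (z * s)))
    (Beta a b * kummer_M a (a + b) z)"
proof -
  define g where "g = (\<lambda>s. indicator {0<..<1} s * (s powr (a - 1) * (1 - s) powr (b - 1)))"
  have g: "has_bochner_integral lborel g (Beta a b)"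
    unfolding g_def by (rule has_bochner_integral_Beta[OF a b])
  have gi: "integrable lborel g" using g by (simp add: has_bochner_integral_iff)
  hence gm [measurable]: "g \<in> borel_measurable lborel" by (rule borel_measurable_integrable)
  have g0: "g s \<ge> 0" for s by (simp add: g_def)
  define f where "f = (\<lambda>i s. g s * ((z * s) ^ i / fact i))"
  have fint: "has_bochner_integral lborel (f i)
      (Beta a b * (pochhammer a i / (pochhammer (a + b) i * fact i) * z ^ i))" for i
  proof -
    have "has_bochner_integral lborel (\<lambda>s. z ^ i / fact i * (indicator {0<..<1} s *
        (s powr (a + real i - 1) * (1 - s) powr (b - 1)))) (z ^ i / fact i * Beta (a + real i) b)"
      using has_bochner_integral_Beta[of "a + real i" b] a b
      by (intro has_bochner_integral_mult_right) auto
    also have "(\<lambda>s. z ^ i / fact i * (indicator {0<..<1} s *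
        (s powr (a + real i - 1) * (1 - s) powr (b - 1)))) = f i"
      by (auto simp: f_def g_def fun_eq_iff indicator_def powr_add powr_diff powr_realpow
          power_mult_distrib mult_ac)
    finally show ?thesis using Beta_add_nat_left[OF a b, of i] by (simp add: field_simps)
  qed
  have norm_le: "norm (f i s) \<le> g s * (\<bar>z\<bar> ^ i / fact i)" for i s
  proof (cases "s \<in> {0<..<1}")
    case True
    hence "\<bar>z * s\<bar> ^ i \<le> \<bar>z\<bar> ^ i"
      by (intro power_mono) (auto simp: abs_mult intro!: mult_left_le)
    hence "g s * (\<bar>z * s\<bar> ^ i / fact i) \<le> g s * (\<bar>z\<bar> ^ i / fact i)"
      by (intro mult_left_mono divide_right_mono g0) auto
    thus ?thesis using g0[of s] by (simp add: f_def abs_mult power_abs)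
  qed (simp add: f_def g_def)
  have sz: "summable (\<lambda>i. \<bar>z\<bar> ^ i / fact i)"
    using summable_exp[of "\<bar>z\<bar>"] by (simp add: field_simps)
  have s1: "AE s in lborel. summable (\<lambda>i. norm (f i s))"
    by (intro AE_I2 summable_comparison_test'[OF summable_mult[OF sz]]) (use norm_le in auto)
  have s2: "summable (\<lambda>i. \<integral>s. norm (f i s) \<partial>lborel)"
  proof (rule summable_comparison_test'[OF summable_mult[OF sz, of "Beta a b"]])
    fix i
    have "(\<integral>s. norm (f i s) \<partial>lborel) \<le> (\<integral>s. g s * (\<bar>z\<bar> ^ i / fact i) \<partial>lborel)"
      using fint[of i] gi norm_le
      by (intro integral_mono) (auto simp: has_bochner_integral_iff)
    thus "norm (\<integral>s. norm (f i s) \<partial>lborel) \<le> Beta a b * (\<bar>z\<bar> ^ i / fact i)"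
      using g by (simp add: has_bochner_integral_iff)
  qed
  have fi: "integrable lborel (f i)" for i using fint[of i] by (simp add: has_bochner_integral_iff)
  have fsum: "(\<Sum>i. f i s) = g s * exp (z * s)" for s
  proof -
    have "(\<lambda>i. g s * ((z * s) ^ i / fact i)) sums (g s * exp (z * s))"
      using exp_converges[of "z * s"] by (intro sums_mult) (simp add: field_simps)
    thus ?thesis by (simp add: f_def sums_iff)
  qed
  have int: "integrable lborel (\<lambda>s. g s * exp (z * s))"
    using integrable_suminf[OF fi s1 s2] by (simp add: fsum)
  have "(\<lambda>i. Beta a b * (pochhammer a i / (pochhammer (a + b) i * fact i) * z ^ i))
      sums (\<integral>s. g s * exp (z * s) \<partial>lborel)"
    using sums_integral[OF fi s1 s2] fint by (simp add: fsum has_bochner_integral_iff)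
  moreover have "Beta a b \<noteq> 0"
    using a b by (auto simp: Beta_def Gamma_eq_zero_iff dest!: nonpos_Ints_nonpos)
  ultimately have "(\<lambda>i. pochhammer a i / (pochhammer (a + b) i * fact i) * z ^ i)
      sums ((\<integral>s. g s * exp (z * s) \<partial>lborel) / Beta a b)"
    by (subst sums_mult_iff[symmetric, of "Beta a b"]) auto
  hence "kummer_M a (a + b) z = (\<integral>s. g s * exp (z * s) \<partial>lborel) / Beta a b"
    unfolding kummer_M_def by (rule sums_unique[symmetric])
  hence "(\<integral>s. g s * exp (z * s) \<partial>lborel) = Beta a b * kummer_M a (a + b) z"
    using \<open>Beta a b \<noteq> 0\<close> by simp
  with int show ?thesis by (simp add: has_bochner_integral_iff g_def mult.assoc)
qed

subsection \<open>The density of the sum\<close>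

text \<open>Coefficients of the reverse Bessel polynomial of degree \<open>m\<close> divided by
  \<open>2 ^ (m + 1) * fact m\<close>. With \<open>i = m - j\<close> they become the coefficients of
  the final formula. The value 0 beyond the degree lets the recurrence hold at every index.\<close>

definition laplace_coeff :: "nat \<Rightarrow> nat \<Rightarrow> real" where
  "laplace_coeff m i = (if i \<le> m then
     fact (2 * m - i) / (fact i * fact (m - i) * 2 ^ (m - i)) / (2 ^ (m + 1) * fact m) else 0)"

definition laplace_poly :: "nat \<Rightarrow> real poly" where
  "laplace_poly m = (\<Sum>i\<le>m. monom (laplace_coeff m i) i)"

lemma coeff_laplace_poly: "coeff (laplace_poly m) i = laplace_coeff m i"
proof -
  have "coeff (laplace_poly m) i = (\<Sum>k\<le>m. if k = i then laplace_coeff m k else 0)"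
    by (simp add: laplace_poly_def coeff_sum)
  also have "\<dots> = laplace_coeff m i" by (simp add: sum.delta laplace_coeff_def)
  finally show ?thesis .
qed

lemma poly_laplace_poly: "poly (laplace_poly m) x = (\<Sum>i\<le>m. laplace_coeff m i * x ^ i)"
  by (simp add: laplace_poly_def poly_sum poly_monom)

lemma poly_laplace_poly_nonneg: "x \<ge> 0 \<Longrightarrow> poly (laplace_poly m) x \<ge> 0"
  unfolding poly_laplace_poly by (intro sum_nonneg mult_nonneg_nonneg) (auto simp: laplace_coeff_def)

text \<open>Coefficientwise form of \<open>Q - Q''\<close> for \<open>Q t = exp (- t) * R t\<close>,
  which is \<open>exp (- t) * (2 * R' t - R'' t)\<close>.\<close>

lemma laplace_coeff_rec:
  "laplace_coeff m i = 2 * real (i + 1) * laplace_coeff (m + 1) (i + 1)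
     - real (i + 1) * real (i + 2) * laplace_coeff (m + 1) (i + 2)"
proof (cases "i \<le> m")
  case True
  then obtain k where m: "m = i + k" using le_Suc_ex by blast
  show ?thesis
  proof (cases k)
    \<comment> \<open>Here \<open>i = m\<close>, and the second coefficient on the right lies beyond
      the degree, so it is 0 by convention instead of being given by the factorial
      expression.\<close>
    case 0
    define B where "B = (fact i :: real)"
    define H where "H = (2 ^ i :: real)"
    have pos: "B > 0" "H > 0" by (simp_all add: B_def H_def)
    have a: "laplace_coeff m i = 1 / (2 * H * B)"
      unfolding m 0 laplace_coeff_def B_def H_def by simp
    have b: "laplace_coeff (m + 1) (i + 1) = 1 / (4 * H * ((real i + 1) * B))"
      unfolding m 0 laplace_coeff_def B_def H_def by (simp add: ac_simps)
    have c: "laplace_coeff (m + 1) (i + 2) = 0"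
      unfolding m 0 laplace_coeff_def by simp
    show ?thesis unfolding a b c using pos by (simp add: divide_simps add_nonneg_eq_0_iff)
  next
    case (Suc l)
    have 1: "2 * (i + Suc l) - i = i + 2 * l + 2" "2 * (i + Suc l + 1) - (i + 1) = Suc (i + 2 * l + 2)"
      "2 * (i + Suc l + 1) - (i + 2) = i + 2 * l + 2" "i + Suc l - i = Suc l"
      "i + Suc l + 1 - (i + 1) = Suc l" "i + Suc l + 1 - (i + 2) = l"
      by simp_all
    \<comment> \<open>Once factorials and powers are reduced to these atoms, the claim is a rational
      identity in \<open>i\<close> and \<open>l\<close>.\<close>
    define A where "A = (fact (i + 2 * l + 2) :: real)"
    define B where "B = (fact i :: real)"
    define C where "C = (fact l :: real)"
    define D where "D = (fact (i + Suc l) :: real)"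
    define E where "E = (2 ^ l :: real)"
    define H where "H = (2 ^ (i + l) :: real)"
    have pos: "B > 0" "C > 0" "D > 0" "E > 0" "H > 0"
      by (simp_all add: B_def C_def D_def E_def H_def)
    have facts: "fact (Suc (i + 2 * l + 2)) = (real i + 2 * real l + 3) * A"
      "fact (Suc l) = (real l + 1) * C" "fact (i + 1) = (real i + 1) * B"
      "fact (i + 2) = (real i + 2) * ((real i + 1) * B)"
      "fact (i + Suc l + 1) = (real i + real l + 2) * D"
      by (simp_all add: A_def B_def C_def D_def algebra_simps)
    have powers: "2 ^ Suc l = 2 * E" "2 ^ (i + Suc l + 1) = 4 * H" "2 ^ (i + Suc l + 1 + 1) = 8 * H"
      by (simp_all add: E_def H_def)
    note unfolds = m Suc laplace_coeff_def 1 facts powers A_def[symmetric] B_def[symmetric]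
      C_def[symmetric] D_def[symmetric] E_def[symmetric]
    have a: "laplace_coeff m i = A / (B * ((real l + 1) * C) * (2 * E)) / (4 * H * D)"
      unfolding unfolds by simp
    have b: "laplace_coeff (m + 1) (i + 1) = (real i + 2 * real l + 3) * A
        / ((real i + 1) * B * ((real l + 1) * C) * (2 * E)) / (8 * H * ((real i + real l + 2) * D))"
      unfolding unfolds by simp
    have c: "laplace_coeff (m + 1) (i + 2) = A
        / ((real i + 2) * ((real i + 1) * B) * C * E) / (8 * H * ((real i + real l + 2) * D))"
      unfolding unfolds by simp
    show ?thesis unfolding a b c using pos
      by (simp add: divide_simps add_nonneg_eq_0_iff) (simp add: algebra_simps)
  qed
qed (auto simp: laplace_coeff_def)

lemma laplace_poly_rec:
  "laplace_poly m = smult 2 (pderiv (laplace_poly (m + 1))) - pderiv (pderiv (laplace_poly (m + 1)))"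
proof (rule poly_eqI)
  fix i
  show "coeff (laplace_poly m) i = coeff (smult 2 (pderiv (laplace_poly (m + 1)))
      - pderiv (pderiv (laplace_poly (m + 1)))) i"
    using laplace_coeff_rec[of m i] by (simp add: coeff_pderiv coeff_laplace_poly algebra_simps)
qed

text \<open>This makes \<open>exp (- \<bar>t\<bar>) * R \<bar>t\<bar>\<close> differentiable at 0,
  where its one-sided derivatives are \<open>R' 0 - R 0\<close> and the negative of it. The index
  starts at 1 because the Laplace density itself has a kink.\<close>

lemma laplace_poly_pderiv_0:
  "poly (pderiv (laplace_poly (m + 1))) 0 = poly (laplace_poly (m + 1)) 0"
proof -
  define A where "A = (fact (2 * m + 1) :: real)"
  define B where "B = (fact m :: real)"
  define H where "H = (2 ^ m :: real)"
  have pos: "A > 0" "B > 0" "H > 0" by (simp_all add: A_def B_def H_def)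
  have "(fact (2 * m + 2) :: real) = (2 * real m + 2) * A"
    by (simp add: A_def algebra_simps)
  hence a: "laplace_coeff (m + 1) 0 = (2 * real m + 2) * A / ((real m + 1) * B * (2 * H)) /
      (4 * H * ((real m + 1) * B))"
    unfolding laplace_coeff_def B_def H_def by (simp add: algebra_simps)
  have b: "laplace_coeff (m + 1) 1 = A / (B * H) / (4 * H * ((real m + 1) * B))"
    unfolding laplace_coeff_def A_def B_def H_def by (simp add: algebra_simps)
  have "laplace_coeff (m + 1) 1 = laplace_coeff (m + 1) 0"
    unfolding a b using pos by (simp add: divide_simps add_nonneg_eq_0_iff)
  thus ?thesis by (simp add: poly_0_coeff_0 coeff_pderiv coeff_laplace_poly)
qed

section \<open>Convolution with the Laplace kernel\<close>

lemma DERIV_if_ge_0: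
  fixes f g f' g' :: "real \<Rightarrow> real"
  assumes f: "\<And>t. (f has_real_derivative f' t) (at t)"
    and g: "\<And>t. (g has_real_derivative g' t) (at t)"
    and eq: "f 0 = g 0" "f' 0 = g' 0"
  shows "((\<lambda>t. if 0 \<le> t then f t else g t) has_real_derivative (if 0 \<le> t then f' t else g' t)) (at t)"
proof -
  consider "t > 0" | "t < 0" | "t = 0" by linarith
  thus ?thesis
  proof cases
    case 1
    thus ?thesis using f[of t]
      by (auto intro!: has_field_derivative_transform_within_open[of f "f' t" t "{0<..}"])
  next
    case 2
    thus ?thesis using g[of t]
      by (auto intro!: has_field_derivative_transform_within_open[of g "g' t" t "{..<0}"])
  next
    case 3
    have "((\<lambda>t. if 0 \<le> t then f t else g t) has_real_derivative f' 0) (at 0 within {0..})"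
      by (rule has_field_derivative_transform_within[OF has_field_derivative_at_within[OF f[of 0]], of 1])
        auto
    hence "((\<lambda>t. if 0 \<le> t then f t else g t) has_real_derivative f' 0) (at_right 0)"
      by (rule DERIV_subset) auto
    moreover have "((\<lambda>t. if 0 \<le> t then f t else g t) has_real_derivative f' 0) (at_left 0)"
    proof -
      have "((\<lambda>t. if 0 \<le> t then f t else g t) has_real_derivative f' 0) (at 0 within {..0})"
        unfolding eq(2) using eq(1)
        by (intro has_field_derivative_transform_within[OF has_field_derivative_at_within[OF g[of 0]], of 1])
          auto
      thus ?thesis by (rule DERIV_subset) auto
    qed
    ultimately show ?thesis
      using 3 by (simp add: has_field_derivative_iff filterlim_split_at)
  qed
qed

lemma poly_times_exp_tendsto_0:
  fixes q :: "real poly"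
  shows "((\<lambda>y. exp (- y) * poly q y) \<longlongrightarrow> 0) at_top"
proof -
  have "((\<lambda>y. \<Sum>i\<le>degree q. coeff q i * (y ^ i / exp y)) \<longlongrightarrow> (\<Sum>i\<le>degree q. coeff q i * 0)) at_top"
    by (intro tendsto_intros tendsto_power_div_exp_0)
  thus ?thesis
    by (simp add: poly_altdef exp_minus sum_distrib_left field_simps)
qed

text \<open>
  With \<open>Q t = exp (- \<bar>t\<bar>) * poly R \<bar>t\<bar>\<close>, the conditions on \<open>R\<close> say that \<open>Q\<close> is twice
  differentiable and that the integrated density is \<open>Q - Q''\<close>. Hence \<open>- exp (- y) * (Q y + Q' y)\<close>
  is an antiderivative of the integrand.
\<close>

lemma nn_integral_exp_tail:
  fixes P R :: "real poly"
  assumes P: "P = smult 2 (pderiv R) - pderiv (pderiv R)"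
    and R: "poly (pderiv R) 0 = poly R 0"
    and nn: "\<And>u. u \<ge> 0 \<Longrightarrow> poly P u \<ge> 0"
  shows "(\<integral>\<^sup>+y. ennreal (exp (x - y) * (exp (- \<bar>y\<bar>) * poly P \<bar>y\<bar>)) * indicator {x..} y \<partial>lborel)
    = ennreal (exp (- \<bar>x\<bar>) * (poly R \<bar>x\<bar> + sgn x * (poly (pderiv R) \<bar>x\<bar> - poly R \<bar>x\<bar>)))"
proof -
  define Q where "Q = (\<lambda>t. if 0 \<le> t then exp (- t) * poly R t else exp t * poly R (- t))"
  define Q1 where "Q1 = (\<lambda>t. if 0 \<le> t then exp (- t) * (poly (pderiv R) t - poly R t)
    else exp t * (poly R (- t) - poly (pderiv R) (- t)))"
  define p where "p = (\<lambda>t. exp (- \<bar>t\<bar>) * poly P \<bar>t\<bar>)"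
  have Q: "(Q has_real_derivative Q1 t) (at t)" for t
    unfolding Q_def Q1_def
    by (rule DERIV_if_ge_0) (auto intro!: derivative_eq_intros poly_DERIV[THEN DERIV_chain2] simp: R algebra_simps)
  have "(Q1 has_real_derivative
    (if 0 \<le> t then exp (- t) * (poly (pderiv (pderiv R)) t - 2 * poly (pderiv R) t + poly R t)
     else exp t * (poly (pderiv (pderiv R)) (- t) - 2 * poly (pderiv R) (- t) + poly R (- t)))) (at t)" for t
    unfolding Q1_def
    by (rule DERIV_if_ge_0) (auto intro!: derivative_eq_intros poly_DERIV[THEN DERIV_chain2] simp: R algebra_simps)
  also have "(\<lambda>t. if 0 \<le> t then exp (- t) * (poly (pderiv (pderiv R)) t - 2 * poly (pderiv R) t + poly R t)
     else exp t * (poly (pderiv (pderiv R)) (- t) - 2 * poly (pderiv R) (- t) + poly R (- t)))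
    = (\<lambda>t. Q t - p t)"
    by (auto simp: fun_eq_iff Q_def p_def P algebra_simps)
  finally have Q1: "(Q1 has_real_derivative Q t - p t) (at t)" for t .
  define F where "F = (\<lambda>y. - (exp (x - y) * (Q y + Q1 y)))"
  have F: "(F has_real_derivative exp (x - y) * p y) (at y)" for y
    unfolding F_def by (auto intro!: derivative_eq_intros Q Q1 simp: algebra_simps)
  have "(F \<longlongrightarrow> 0) at_top"
  proof -
    \<comment> \<open>For \<open>y \<ge> 0\<close> the terms in \<open>R\<close> cancel in
      \<open>Q y + Q1 y\<close>, leaving \<open>exp (- y) * poly (pderiv R) y\<close>; this function
      therefore agrees with \<open>F\<close> eventually.\<close>
    have "((\<lambda>y. - (exp x * exp (- y) * (exp (- y) * poly (pderiv R) y))) \<longlongrightarrow> - (exp x * 0 * 0)) at_top"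
      by (intro tendsto_intros poly_times_exp_tendsto_0 filterlim_compose[OF exp_at_bot]
          filterlim_uminus_at_bot_at_top)
    hence "((\<lambda>y. - (exp x * exp (- y) * (exp (- y) * poly (pderiv R) y))) \<longlongrightarrow> 0) at_top" by simp
    thus ?thesis
      by (rule Lim_transform_eventually)
        (use eventually_ge_at_top[of 0] in eventually_elim, simp add: F_def Q_def Q1_def exp_diff exp_minus field_simps)
  qed
  moreover have "(\<lambda>y. exp (x - y) * p y) \<in> borel_measurable borel"
    unfolding p_def poly_altdef by measurable
  moreover have "exp (x - y) * p y \<ge> 0" for y using nn[of "\<bar>y\<bar>"] by (simp add: p_def)
  ultimately have "(\<integral>\<^sup>+y. ennreal (exp (x - y) * p y) * indicator {x..} y \<partial>lborel) = ennreal (0 - F x)"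
    by (intro nn_integral_FTC_atLeast F)
  \<comment> \<open>\<open>- F x\<close> is \<open>Q x + Q1 x\<close> with \<open>Q\<close> even and
    \<open>Q1\<close> odd, hence the \<open>sgn\<close>. At 0 the term \<open>Q1 0\<close> vanishes
    by assumption \<open>R\<close>.\<close>
  also have "0 - F x = exp (- \<bar>x\<bar>) * (poly R \<bar>x\<bar> + sgn x * (poly (pderiv R) \<bar>x\<bar> - poly R \<bar>x\<bar>))"
  proof -
    consider "x > 0" | "x < 0" | "x = 0" by linarith
    thus ?thesis
      by cases (simp_all add: F_def Q_def Q1_def R algebra_simps)
  qed
  finally show ?thesis by (simp add: p_def)
qed

definition laplace_sum_density :: "nat \<Rightarrow> real \<Rightarrow> real" where
  "laplace_sum_density m t = exp (- \<bar>t\<bar>) * poly (laplace_poly m) \<bar>t\<bar>"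

lemma laplace_sum_density_nonneg: "laplace_sum_density m t \<ge> 0"
  by (simp add: laplace_sum_density_def poly_laplace_poly_nonneg)

lemma laplace_sum_density_minus [simp]: "laplace_sum_density m (- t) = laplace_sum_density m t"
  by (simp add: laplace_sum_density_def)

lemma laplace_sum_density_measurable [measurable]: "laplace_sum_density m \<in> borel_measurable borel"
  unfolding laplace_sum_density_def poly_laplace_poly by measurable

text \<open>The integral is cut at \<open>y = x\<close>. The right half is the tail integral at
  \<open>x\<close>, and by evenness the left half is the tail integral at \<open>- x\<close>; in
  their sum the \<open>sgn\<close> terms cancel.\<close>

lemma laplace_sum_density_convolution:
  "(\<integral>\<^sup>+y. ennreal (exp (- \<bar>x - y\<bar>)) * ennreal (laplace_sum_density m y) \<partial>lborel)
    = ennreal (2 * laplace_sum_density (m + 1) x)"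
proof -
  define R where "R = laplace_poly (m + 1)"
  define k where "k = (\<lambda>x y. ennreal (exp (x - y) * laplace_sum_density m y) * indicator {x..} y)"
  have k_meas [measurable]: "k x \<in> borel_measurable borel" for x unfolding k_def by measurable
  have k: "(\<integral>\<^sup>+y. k x y \<partial>lborel)
    = ennreal (exp (- \<bar>x\<bar>) * (poly R \<bar>x\<bar> + sgn x * (poly (pderiv R) \<bar>x\<bar> - poly R \<bar>x\<bar>)))" for x
    unfolding k_def laplace_sum_density_def R_def
    by (rule nn_integral_exp_tail[OF laplace_poly_rec laplace_poly_pderiv_0 poly_laplace_poly_nonneg])
  \<comment> \<open>\<open>ennreal\<close> truncates negative numbers, so both halves must be
    nonnegative to be added. For negative \<open>x\<close> this means \<open>R' \<le> 2 * R\<close>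
    at \<open>\<bar>x\<bar>\<close>, which holds because \<open>2 * R - R'\<close> is nonnegative at
    0 and has derivative \<open>laplace_poly m\<close>.\<close>
  have kr: "exp (- \<bar>x\<bar>) * (poly R \<bar>x\<bar> + sgn x * (poly (pderiv R) \<bar>x\<bar> - poly R \<bar>x\<bar>)) \<ge> 0" for x
  proof -
    have c: "coeff R i \<ge> 0" for i unfolding R_def coeff_laplace_poly laplace_coeff_def by simp
    hence "poly R \<bar>x\<bar> \<ge> 0" "poly (pderiv R) \<bar>x\<bar> \<ge> 0"
      by (auto simp: poly_altdef coeff_pderiv intro!: sum_nonneg mult_nonneg_nonneg)
    moreover have "poly (pderiv R) \<bar>x\<bar> \<le> 2 * poly R \<bar>x\<bar>"
    proof -
      have "poly (smult 2 R - pderiv R) 0 \<le> poly (smult 2 R - pderiv R) \<bar>x\<bar>"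
      proof (rule DERIV_nonneg_imp_nondecreasing[where f = "poly (smult 2 R - pderiv R)"])
        fix u :: real assume "0 \<le> u"
        moreover have "pderiv (smult 2 R - pderiv R) = laplace_poly m"
          unfolding laplace_poly_rec[of m] R_def by (simp add: pderiv_diff pderiv_smult)
        ultimately show "\<exists>y. (poly (smult 2 R - pderiv R) has_real_derivative y) (at u) \<and> 0 \<le> y"
          using poly_DERIV[of "smult 2 R - pderiv R" u] poly_laplace_poly_nonneg[of u m] by metis
      qed simp
      moreover have "poly (smult 2 R - pderiv R) 0 \<ge> 0"
        using laplace_poly_pderiv_0[of m] c[of 0] by (simp add: R_def poly_0_coeff_0)
      ultimately show ?thesis by simp
    qed
    ultimately show ?thesis by (auto simp: sgn_real_def)
  qed
  have "(\<integral>\<^sup>+y. ennreal (exp (- \<bar>x - y\<bar>)) * ennreal (laplace_sum_density m y) \<partial>lborel)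
    = (\<integral>\<^sup>+y. k x y + k (- x) (- y) \<partial>lborel)"
  \<comment> \<open>Both half-lines are closed, so the split counts the point \<open>y = x\<close>
    twice.\<close>
  proof (rule nn_integral_cong_AE)
    have "AE y in lborel. y \<noteq> x" by (rule AE_lborel_singleton)
    thus "AE y in lborel. ennreal (exp (- \<bar>x - y\<bar>)) * ennreal (laplace_sum_density m y)
      = k x y + k (- x) (- y)"
      by eventually_elim
        (auto simp: k_def indicator_def ennreal_mult laplace_sum_density_nonneg)
  qed
  also have "\<dots> = (\<integral>\<^sup>+y. k x y \<partial>lborel) + (\<integral>\<^sup>+y. k (- x) (- y) \<partial>lborel)"
    by (rule nn_integral_add) auto
  also have "(\<integral>\<^sup>+y. k (- x) (- y) \<partial>lborel) = (\<integral>\<^sup>+y. k (- x) y \<partial>lborel)"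
    using nn_integral_real_affine[of "k (- x)" "- 1" 0] by simp
  also have "(\<integral>\<^sup>+y. k x y \<partial>lborel) + (\<integral>\<^sup>+y. k (- x) y \<partial>lborel)
      = ennreal (2 * laplace_sum_density (m + 1) x)"
    unfolding k using kr[of x] kr[of "- x"]
    by (subst ennreal_plus[symmetric]) (auto simp: laplace_sum_density_def R_def algebra_simps sgn_minus)
  finally show ?thesis .
qed

section \<open>Tilting, translation and independent sums\<close>

text \<open>The density of a sum of \<open>m + 1\<close> (rather than \<open>m\<close>) independent copies.\<close>

definition AL_sum_density :: "real \<Rightarrow> real \<Rightarrow> real \<Rightarrow> nat \<Rightarrow> real \<Rightarrow> real" where
  "AL_sum_density \<alpha> \<beta> \<mu> m x = (1 - \<beta>\<^sup>2 / \<alpha>\<^sup>2) ^ (m + 1) * \<alpha> *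
     exp (\<beta> * (x - real (m + 1) * \<mu>)) * laplace_sum_density m (\<alpha> * (x - real (m + 1) * \<mu>))"

lemma AL_sum_density_0: "\<alpha> > 0 \<Longrightarrow> AL_sum_density \<alpha> \<beta> \<mu> 0 x = AL_density \<alpha> \<beta> \<mu> x"
  using abs_mult[of \<alpha> "x - \<mu>"]
  by (simp add: AL_sum_density_def AL_density_def laplace_sum_density_def poly_laplace_poly
      laplace_coeff_def exp_diff exp_minus exp_add field_simps power2_eq_square)

lemma AL_density_measurable [measurable]: "AL_density \<alpha> \<beta> \<mu> \<in> borel_measurable borel"
  unfolding AL_density_def by measurable

lemma one_minus_square_ratio_pos:
  fixes \<alpha> \<beta> :: real
  assumes "\<bar>\<beta>\<bar> < \<alpha>" shows "1 - \<beta>\<^sup>2 / \<alpha>\<^sup>2 > 0"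
  using assms abs_square_less_1[of "\<beta> / \<alpha>"] by (simp add: power_divide abs_divide)

lemma AL_sum_density_nonneg: "\<bar>\<beta>\<bar> < \<alpha> \<Longrightarrow> AL_sum_density \<alpha> \<beta> \<mu> m x \<ge> 0"
  unfolding AL_sum_density_def
  by (intro mult_nonneg_nonneg laplace_sum_density_nonneg zero_le_power less_imp_le
      one_minus_square_ratio_pos) auto

lemma AL_sum_density_measurable [measurable]: "AL_sum_density \<alpha> \<beta> \<mu> m \<in> borel_measurable borel"
  unfolding AL_sum_density_def by measurable

text \<open>Under \<open>y = (m + 1) * \<mu> + u / \<alpha>\<close> the two exponential tilts
  multiply to \<open>exp (\<beta> * z)\<close>, which is constant in \<open>u\<close>, and the
  untilted convolution remains.\<close>

lemma AL_sum_density_convolution: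
  assumes ab: "\<bar>\<beta>\<bar> < \<alpha>"
  shows "(\<integral>\<^sup>+y. ennreal (AL_density \<alpha> \<beta> \<mu> (x - y)) * ennreal (AL_sum_density \<alpha> \<beta> \<mu> m y) \<partial>lborel)
    = ennreal (AL_sum_density \<alpha> \<beta> \<mu> (m + 1) x)"
proof -
  define \<kappa> where "\<kappa> = 1 - \<beta>\<^sup>2 / \<alpha>\<^sup>2"
  have \<kappa>: "\<kappa> > 0" unfolding \<kappa>_def by (rule one_minus_square_ratio_pos[OF ab])
  have a: "\<alpha> > 0" using ab by simp
  define z where "z = x - real (m + 2) * \<mu>"
  \<comment> \<open>One factor \<open>\<kappa>\<close> comes from the single density and
    \<open>m + 1\<close> from the sum. The \<open>1 / 2\<close> cancels the 2 of the untilted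
    convolution, and the extra \<open>\<alpha>\<close> in \<open>\<alpha> * c\<close> cancels the
    Jacobian.\<close>
  define c where "c = \<kappa> ^ (m + 2) * \<alpha> / 2 * exp (\<beta> * z)"
  have c: "c \<ge> 0" using \<kappa> a by (simp add: c_def)
  have shift: "AL_density \<alpha> \<beta> \<mu> (x - (real (m + 1) * \<mu> + 1 / \<alpha> * u)) * AL_sum_density \<alpha> \<beta> \<mu> m (real (m + 1) * \<mu> + 1 / \<alpha> * u)
    = \<alpha> * c * (exp (- \<bar>\<alpha> * z - u\<bar>) * laplace_sum_density m u)" for u
  proof -
    have 1: "x - (real (m + 1) * \<mu> + 1 / \<alpha> * u) - \<mu> = (\<alpha> * z - u) / \<alpha>"
      using a by (simp add: z_def field_simps)
    have 2: "real (m + 1) * \<mu> + 1 / \<alpha> * u - real (m + 1) * \<mu> = u / \<alpha>" by simp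
    have 3: "(\<alpha>\<^sup>2 - \<beta>\<^sup>2) / (2 * \<alpha>) = \<kappa> * \<alpha> / 2"
      using a by (simp add: \<kappa>_def field_simps power2_eq_square)
    have 4: "\<beta> * ((\<alpha> * z - u) / \<alpha>) = \<beta> * z - \<beta> * (u / \<alpha>)"
      using a by (simp add: field_simps)
    have 5: "\<alpha> * \<bar>(\<alpha> * z - u) / \<alpha>\<bar> = \<bar>\<alpha> * z - u\<bar>" "\<alpha> * (u / \<alpha>) = u"
      using a by (simp_all add: abs_divide)
    show ?thesis
      unfolding AL_density_def AL_sum_density_def 1 2 3 4 5 \<kappa>_def[symmetric] c_def
      by (simp add: exp_diff exp_minus exp_add field_simps)
  qed
  have "(\<integral>\<^sup>+y. ennreal (AL_density \<alpha> \<beta> \<mu> (x - y)) * ennreal (AL_sum_density \<alpha> \<beta> \<mu> m y) \<partial>lborel)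
    = (\<integral>\<^sup>+y. ennreal (AL_density \<alpha> \<beta> \<mu> (x - y) * AL_sum_density \<alpha> \<beta> \<mu> m y) \<partial>lborel)"
    using AL_sum_density_nonneg[OF ab] a
    by (simp add: ennreal_mult AL_sum_density_0[symmetric])
  also have "\<dots> = ennreal \<bar>1 / \<alpha>\<bar> * (\<integral>\<^sup>+u. ennreal (\<alpha> * c * (exp (- \<bar>\<alpha> * z - u\<bar>) * laplace_sum_density m u)) \<partial>lborel)"
    unfolding shift[symmetric] using a by (intro nn_integral_real_affine) auto
  also have "\<dots> = ennreal (1 / \<alpha>) * (\<integral>\<^sup>+u. ennreal (\<alpha> * c) * (ennreal (exp (- \<bar>\<alpha> * z - u\<bar>)) * ennreal (laplace_sum_density m u)) \<partial>lborel)"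
    using a c by (simp add: ennreal_mult laplace_sum_density_nonneg)
  also have "\<dots> = ennreal (1 / \<alpha>) * (ennreal (\<alpha> * c) * ennreal (2 * laplace_sum_density (m + 1) (\<alpha> * z)))"
    by (subst nn_integral_cmult) (auto simp: laplace_sum_density_convolution)
  also have "\<dots> = ennreal (1 / \<alpha> * (\<alpha> * c * (2 * laplace_sum_density (m + 1) (\<alpha> * z))))"
    using a c by (simp add: ennreal_mult[symmetric] laplace_sum_density_nonneg)
  also have "1 / \<alpha> * (\<alpha> * c * (2 * laplace_sum_density (m + 1) (\<alpha> * z))) = AL_sum_density \<alpha> \<beta> \<mu> (m + 1) x"
    using a by (simp add: c_def AL_sum_density_def \<kappa>_def z_def)
  finally show ?thesis .
qed

lemma (in prob_space) distributed_sum_AL: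
  assumes ab: "\<bar>\<beta>\<bar> < \<alpha>" and I: "finite I" "I \<noteq> {}"
    and ind: "indep_vars (\<lambda>_. borel) X I"
    and X: "\<And>i. i \<in> I \<Longrightarrow> distributed M lborel (X i) (\<lambda>x. ennreal (AL_density \<alpha> \<beta> \<mu> x))"
  shows "distributed M lborel (\<lambda>\<omega>. \<Sum>i\<in>I. X i \<omega>) (\<lambda>x. ennreal (AL_sum_density \<alpha> \<beta> \<mu> (card I - 1) x))"
  using I ind X
proof (induct rule: finite_ne_induct)
  case (singleton i)
  thus ?case using ab by (simp add: AL_sum_density_0)
next
  case (insert i I)
  have IH: "distributed M lborel (\<lambda>\<omega>. \<Sum>i\<in>I. X i \<omega>) (\<lambda>x. ennreal (AL_sum_density \<alpha> \<beta> \<mu> (card I - 1) x))"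
    using insert by (auto intro: indep_vars_subset)
  have "indep_var borel (X i) borel (\<lambda>\<omega>. \<Sum>i\<in>I. X i \<omega>)"
    using insert by (intro indep_vars_sum) auto
  from distributed_convolution[OF this insert.prems(2)[of i] IH]
  have "distributed M lborel (\<lambda>\<omega>. X i \<omega> + (\<Sum>i\<in>I. X i \<omega>))
      (\<lambda>x. ennreal (AL_sum_density \<alpha> \<beta> \<mu> (card I - 1 + 1) x))"
    by (simp only: AL_sum_density_convolution[OF ab]) auto
  \<comment> \<open>The subtraction is not truncated, since the induction runs over nonempty
    sets.\<close>
  moreover have "card I - 1 + 1 = card (insert i I) - 1"
    using insert by (simp add: card_gt_0_iff)
  ultimately show ?case using insert by simp
qed

subsection \<open>Absolute moments\<close>

lemma has_bochner_integral_affine: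
  fixes f :: "real \<Rightarrow> real"
  assumes "has_bochner_integral lborel f v" "\<bar>c\<bar> = 1"
  shows "has_bochner_integral lborel (\<lambda>x. f (t + c * x)) v"
proof -
  have "c \<noteq> 0" using assms(2) by auto
  from lborel_has_bochner_integral_real_affine_iff[OF this, of f v t] assms show ?thesis by simp
qed

text \<open>The substitutions \<open>w = - s\<close>, \<open>w = 1 - s\<close> and
  \<open>w = 1 + s\<close> on the pieces cut out by 0 and 1 give the three summands. The exponent
  has slope \<open>A + B\<close> to the left of 1 and \<open>- (A - B)\<close> to the right, hence
  the two different arguments.\<close>

lemma has_bochner_integral_shifted_moment_unit:
  fixes r A B :: real and i :: nat
  assumes r: "r > -1" and AB: "\<bar>B\<bar> < A"
  shows "has_bochner_integral lborel
    (\<lambda>w. \<bar>w\<bar> powr r * (exp (B * (w - 1) - A * \<bar>w - 1\<bar>) * \<bar>w - 1\<bar> ^ i))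
    (exp (- (A + B)) * euler_integral r (real i) (A + B)
     + Beta (r + 1) (real i + 1) * kummer_M (real i + 1) (r + real i + 2) (- (A + B))
     + euler_integral (real i) r (A - B))"
proof -
  define f where "f = (\<lambda>w. \<bar>w\<bar> powr r * (exp (B * (w - 1) - A * \<bar>w - 1\<bar>) * \<bar>w - 1\<bar> ^ i))"
  define k where "k = (\<lambda>s. indicator {0<..<1} s * (s powr (real i + 1 - 1) * (1 - s) powr (r + 1 - 1)
      * exp (- (A + B) * s)))"
  have euler: "has_bochner_integral lborel (euler_kernel p q x) (euler_integral p q x)"
    if "p > -1" "x > 0" for p q x
    using integrable_euler_kernel[OF that] by (simp add: has_bochner_integral_iff euler_integral_def)
  have "has_bochner_integral lborel (\<lambda>w. exp (- (A + B)) * euler_kernel r (real i) (A + B) (0 + (- 1) * w))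
    (exp (- (A + B)) * euler_integral r (real i) (A + B))"
    using r AB by (intro has_bochner_integral_mult_right has_bochner_integral_affine euler) auto
  moreover have "has_bochner_integral lborel (\<lambda>w. k (1 + (- 1) * w))
    (Beta (real i + 1) (r + 1) * kummer_M (real i + 1) (real i + 1 + (r + 1)) (- (A + B)))"
    unfolding k_def using r by (intro has_bochner_integral_affine[of "k" for k] kummer_M_integral) auto
  moreover have "has_bochner_integral lborel (\<lambda>w. euler_kernel (real i) r (A - B) (- 1 + 1 * w))
    (euler_integral (real i) r (A - B))"
    using AB by (intro has_bochner_integral_affine euler) auto
  ultimately have "has_bochner_integral lborel
    (\<lambda>w. exp (- (A + B)) * euler_kernel r (real i) (A + B) (0 + (- 1) * w) + k (1 + (- 1) * w)
      + euler_kernel (real i) r (A - B) (- 1 + 1 * w))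
    (exp (- (A + B)) * euler_integral r (real i) (A + B)
     + Beta (real i + 1) (r + 1) * kummer_M (real i + 1) (real i + 1 + (r + 1)) (- (A + B))
     + euler_integral (real i) r (A - B))" (is "has_bochner_integral _ ?g _")
    by (intro has_bochner_integral_add)
  \<comment> \<open>The sides can differ at a breakpoint: for \<open>i = 0\<close> and
    \<open>w = 1\<close> the indicators annihilate \<open>?g\<close>, while \<open>0 ^ 0 = 1\<close>
    keeps \<open>f\<close> positive.\<close>
  moreover have "AE w in lborel. ?g w = f w"
  proof -
    have "AE w in lborel. w \<noteq> 0 \<and> w \<noteq> (1 :: real)"
      using AE_lborel_singleton[of 0] AE_lborel_singleton[of "1 :: real"] by eventually_elim auto
    thus ?thesis
    proof eventually_elim
      fix w :: real assume w: "w \<noteq> 0 \<and> w \<noteq> 1"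
      consider "w < 0" | "0 < w" "w < 1" | "w > 1" using w by linarith
      thus "?g w = f w"
      proof cases
        case 1
        have "exp (- (A + B)) * exp (- ((A + B) * (- w))) = exp (B * (w - 1) - A * \<bar>w - 1\<bar>)"
          unfolding exp_add[symmetric] using 1 by (simp add: algebra_simps)
        thus ?thesis using 1 by (simp add: f_def k_def euler_kernel_def powr_realpow)
      next
        case 2
        have "- (A + B) * (1 - w) = B * (w - 1) - A * \<bar>w - 1\<bar>"
          using 2 by (simp add: algebra_simps)
        thus ?thesis using 2 by (simp add: f_def k_def euler_kernel_def powr_realpow)
      next
        case 3
        have "- ((A - B) * (w - 1)) = B * (w - 1) - A * \<bar>w - 1\<bar>"
          using 3 by (simp add: algebra_simps)
        thus ?thesis using 3 by (simp add: f_def k_def euler_kernel_def powr_realpow)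
      qed
    qed
  qed
  moreover have "?g \<in> borel_measurable lborel" unfolding k_def by measurable
  moreover have "f \<in> borel_measurable lborel" unfolding f_def by measurable
  ultimately have "has_bochner_integral lborel f
    (exp (- (A + B)) * euler_integral r (real i) (A + B)
     + Beta (real i + 1) (r + 1) * kummer_M (real i + 1) (real i + 1 + (r + 1)) (- (A + B))
     + euler_integral (real i) r (A - B))"
    using has_bochner_integral_cong_AE[of ?g lborel f] by blast
  moreover have "real i + 1 + (r + 1) = r + real i + 2" by simp
  ultimately show ?thesis by (simp only: f_def Beta_commute[of "real i + 1"])
qed

text \<open>The rescaling \<open>x = l * w\<close> contributes
  \<open>l powr (r + 1) * A ^ i\<close>, which equals
  \<open>A powr (r + real i + 1) / \<alpha> powr (r + 1)\<close>.\<close>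

lemma has_bochner_integral_shifted_moment_pos:
  fixes \<alpha> \<beta> l r :: real and i :: nat
  assumes ab: "\<bar>\<beta>\<bar> < \<alpha>" and l: "l > 0" and r: "r > -1"
  shows "has_bochner_integral lborel
    (\<lambda>x. \<bar>x\<bar> powr r * (exp (\<beta> * (x - l) - \<alpha> * \<bar>x - l\<bar>) * (\<alpha> * \<bar>x - l\<bar>) ^ i))
    ((exp (- (\<alpha> * l + \<beta> * l)) * Gamma (r + 1) / (1 + \<beta> / \<alpha>) powr (r + real i + 1)
        * tricomi_U (- real i) (- real i - r) (\<alpha> * l + \<beta> * l)
      + (\<alpha> * l) powr (r + real i + 1) * Beta (r + 1) (real i + 1)
        * kummer_M (real i + 1) (r + real i + 2) (- (\<alpha> * l + \<beta> * l))
      + (\<alpha> * l) powr (r + real i + 1) * fact i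
        * tricomi_U (real i + 1) (r + real i + 2) (\<alpha> * l - \<beta> * l)) / \<alpha> powr (r + 1))"
    (is "has_bochner_integral _ ?f ((?T1 + ?T2 + ?T3) / _)")
proof -
  define A B where "A = \<alpha> * l" and "B = \<beta> * l"
  have a: "\<alpha> > 0" using ab by simp
  have l0: "l \<noteq> 0" using l by simp
  have AB: "\<bar>B\<bar> < A" using ab l by (simp add: A_def B_def abs_mult)
  have A: "A > 0" using AB by simp
  define E1 E2 E3 where "E1 = exp (- (A + B)) * euler_integral r (real i) (A + B)"
    and "E2 = Beta (r + 1) (real i + 1) * kummer_M (real i + 1) (r + real i + 2) (- (A + B))"
    and "E3 = euler_integral (real i) r (A - B)"
  have eq: "l powr r * A ^ i * (\<bar>w\<bar> powr r * (exp (B * (w - 1) - A * \<bar>w - 1\<bar>) * \<bar>w - 1\<bar> ^ i))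
      = ?f (0 + l * w)" for w
  proof -
    have "l * w - l = l * (w - 1)" by (simp add: algebra_simps)
    hence "\<bar>l * w - l\<bar> = l * \<bar>w - 1\<bar>" "\<bar>l * w\<bar> = l * \<bar>w\<bar>" "\<beta> * (l * w - l) = B * (w - 1)"
      using l by (auto simp: abs_mult B_def)
    thus ?thesis using l by (simp add: A_def powr_mult power_mult_distrib mult_ac)
  qed
  have "has_bochner_integral lborel (\<lambda>w. ?f (0 + l * w)) (l powr r * A ^ i * (E1 + E2 + E3))"
    unfolding eq[symmetric] E1_def E2_def E3_def
    by (intro has_bochner_integral_mult_right has_bochner_integral_shifted_moment_unit r AB)
  moreover have "l powr r * A ^ i * (E1 + E2 + E3) = (l * (l powr r * A ^ i * (E1 + E2 + E3))) /\<^sub>R \<bar>l\<bar>"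
    using l by simp
  ultimately have "has_bochner_integral lborel (\<lambda>w. ?f (0 + l * w))
      ((l * (l powr r * A ^ i * (E1 + E2 + E3))) /\<^sub>R \<bar>l\<bar>)"
    by (simp only:)
  hence "has_bochner_integral lborel ?f (l * (l powr r * A ^ i * (E1 + E2 + E3)))"
    by (rule lborel_has_bochner_integral_real_affine_iff[where f = ?f and t = 0, OF l0, THEN iffD2])
  also have "l * (l powr r * A ^ i * (E1 + E2 + E3)) = A powr (r + real i + 1) * (E1 + E2 + E3) / \<alpha> powr (r + 1)"
    using l a A by (simp add: powr_add powr_realpow[symmetric]) (simp add: A_def powr_mult field_simps)
  also have "A powr (r + real i + 1) * (E1 + E2 + E3) = ?T1 + ?T2 + ?T3"
  proof -
    define z where "z = A + B"
    have z: "z > 0" using AB by (simp add: z_def)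
    \<comment> \<open>This explains the denominator of the first term: the transformed
      \<open>U\<close> brings a power of \<open>z\<close>, to be compared with the same power of
      \<open>A\<close>.\<close>
    have "1 + \<beta> / \<alpha> = z / A" using a l by (simp add: z_def A_def B_def field_simps)
    hence "?T1 = exp (- z) * (A powr (r + real i + 1) / z powr (r + real i + 1))
        * (Gamma (r + 1) * tricomi_U (- real i) (- real i - r) z)"
      using z A by (simp add: powr_divide z_def A_def B_def algebra_simps)
    also have "\<dots> = A powr (r + real i + 1) * E1"
      unfolding euler_integral_eq_tricomi_U'[OF r z, symmetric] using z by (simp add: E1_def z_def)
    finally have 1: "?T1 = A powr (r + real i + 1) * E1" .
    have 2: "?T2 = A powr (r + real i + 1) * E2" by (simp add: A_def B_def E2_def)
    have "E3 = fact i * tricomi_U (real i + 1) (r + real i + 2) (A - B)"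
      unfolding E3_def using AB euler_integral_eq_tricomi_U[of "real i" "A - B" r] Gamma_fact[of i, where 'a = real]
      by (simp add: add_ac)
    hence 3: "?T3 = A powr (r + real i + 1) * E3" by (simp add: A_def B_def)
    show ?thesis unfolding 1 2 3 by (simp add: algebra_simps)
  qed
  finally show ?thesis .
qed

text \<open>The reflection \<open>x \<mapsto> - x\<close> replaces \<open>\<beta>\<close> and
  \<open>l\<close> by their negatives. It preserves \<open>\<beta> * l\<close>, so only the ratio
  \<open>\<beta> / \<alpha>\<close> acquires the sign of \<open>l\<close>.\<close>

lemma has_bochner_integral_shifted_moment:
  fixes \<alpha> \<beta> l r :: real and i :: nat
  assumes ab: "\<bar>\<beta>\<bar> < \<alpha>" and l: "l \<noteq> 0" and r: "r > -1"
  shows "has_bochner_integral lborel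
    (\<lambda>x. \<bar>x\<bar> powr r * (exp (\<beta> * (x - l) - \<alpha> * \<bar>x - l\<bar>) * (\<alpha> * \<bar>x - l\<bar>) ^ i))
    ((exp (- (\<alpha> * \<bar>l\<bar> + \<beta> * l)) * Gamma (r + 1) / (1 + sgn l * \<beta> / \<alpha>) powr (r + real i + 1)
        * tricomi_U (- real i) (- real i - r) (\<alpha> * \<bar>l\<bar> + \<beta> * l)
      + (\<alpha> * \<bar>l\<bar>) powr (r + real i + 1) * Beta (r + 1) (real i + 1)
        * kummer_M (real i + 1) (r + real i + 2) (- (\<alpha> * \<bar>l\<bar> + \<beta> * l))
      + (\<alpha> * \<bar>l\<bar>) powr (r + real i + 1) * fact i
        * tricomi_U (real i + 1) (r + real i + 2) (\<alpha> * \<bar>l\<bar> - \<beta> * l)) / \<alpha> powr (r + 1))"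
proof (cases "l > 0")
  case True
  thus ?thesis using has_bochner_integral_shifted_moment_pos[OF ab True r, of i] by simp
next
  case False
  hence l': "- l > 0" using l by simp
  have ab': "\<bar>- \<beta>\<bar> < \<alpha>" using ab by simp
  have flip: "\<bar>0 + - 1 * x\<bar> powr r * (exp (- \<beta> * (0 + - 1 * x - - l) - \<alpha> * \<bar>0 + - 1 * x - - l\<bar>)
      * (\<alpha> * \<bar>0 + - 1 * x - - l\<bar>) ^ i)
    = \<bar>x\<bar> powr r * (exp (\<beta> * (x - l) - \<alpha> * \<bar>x - l\<bar>) * (\<alpha> * \<bar>x - l\<bar>) ^ i)" for x
    using abs_minus_commute[of x l] by (simp add: algebra_simps)
  have "\<bar>l\<bar> = - l" "sgn l = - 1" using l' by auto
  thus ?thesis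
    using has_bochner_integral_affine[OF has_bochner_integral_shifted_moment_pos[OF ab' l' r, of i],
        of "- 1" 0] unfolding flip by simp
qed

text \<open>With the centre at 0 the middle interval disappears and each half-line gives a Gamma
  integral. The monomial raises the exponent of \<open>\<bar>x\<bar>\<close> from \<open>r\<close>
  to \<open>r + i\<close>, which is the origin of \<open>Gamma (r + real i + 1)\<close>.\<close>

lemma has_bochner_integral_centred_moment:
  fixes \<alpha> \<beta> r :: real and i :: nat
  assumes ab: "\<bar>\<beta>\<bar> < \<alpha>" and r: "r > -1"
  shows "has_bochner_integral lborel
    (\<lambda>x. \<bar>x\<bar> powr r * (exp (\<beta> * x - \<alpha> * \<bar>x\<bar>) * (\<alpha> * \<bar>x\<bar>) ^ i))
    ((Gamma (r + real i + 1) / (1 + \<beta> / \<alpha>) powr (r + real i + 1)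
      + Gamma (r + real i + 1) / (1 - \<beta> / \<alpha>) powr (r + real i + 1)) / \<alpha> powr (r + 1))"
    (is "has_bochner_integral _ ?f ?v")
proof -
  have a: "\<alpha> > 0" and ap: "\<alpha> + \<beta> > 0" "\<alpha> - \<beta> > 0" using ab by auto
  define g where "g = (\<lambda>c s. \<alpha> ^ i * (indicator {0<..} s * (s powr (r + real i) * exp (- (c * s)))))"
  have g: "has_bochner_integral lborel (g c) (\<alpha> ^ i * (Gamma (r + real i + 1) / c powr (r + real i + 1)))"
    if "c > 0" for c
    unfolding g_def using r that by (intro has_bochner_integral_mult_right has_bochner_integral_Gamma) auto
  have "has_bochner_integral lborel (\<lambda>x. g (\<alpha> + \<beta>) (0 + - 1 * x) + g (\<alpha> - \<beta>) x)
    (\<alpha> ^ i * (Gamma (r + real i + 1) / (\<alpha> + \<beta>) powr (r + real i + 1))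
     + \<alpha> ^ i * (Gamma (r + real i + 1) / (\<alpha> - \<beta>) powr (r + real i + 1)))"
    by (intro has_bochner_integral_add has_bochner_integral_affine g ap) auto
  also have "(\<lambda>x. g (\<alpha> + \<beta>) (0 + - 1 * x) + g (\<alpha> - \<beta>) x) = ?f"
  proof
    fix x :: real
    consider "x > 0" | "x < 0" | "x = 0" by linarith
    thus "g (\<alpha> + \<beta>) (0 + - 1 * x) + g (\<alpha> - \<beta>) x = ?f x"
      unfolding power_mult_distrib by cases (simp_all add: g_def powr_add powr_realpow algebra_simps)
  qed
  also have "\<alpha> ^ i * (Gamma (r + real i + 1) / (\<alpha> + \<beta>) powr (r + real i + 1))
     + \<alpha> ^ i * (Gamma (r + real i + 1) / (\<alpha> - \<beta>) powr (r + real i + 1)) = ?v"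
  proof -
    have 1: "\<alpha> ^ i / (\<alpha> * c) powr (r + real i + 1) = 1 / c powr (r + real i + 1) / \<alpha> powr (r + 1)"
      if "c > 0" for c
      using a that by (simp add: powr_mult powr_add powr_realpow)
    have 2: "\<alpha> + \<beta> = \<alpha> * (1 + \<beta> / \<alpha>)" "\<alpha> - \<beta> = \<alpha> * (1 - \<beta> / \<alpha>)"
      using a by (auto simp: field_simps)
    have "1 + \<beta> / \<alpha> > 0" "1 - \<beta> / \<alpha> > 0" using a ap by (auto simp: field_simps)
    note 3 = this[THEN 1]
    have "\<alpha> ^ i * (G / x) = G * (\<alpha> ^ i / x)" for G x :: real by simp
    thus ?thesis unfolding 2 by (simp only: 3) (simp add: add_divide_distrib)
  qed
  finally show ?thesis .
qed

text \<open>\<open>V\<close> abstracts the moments of the single monomials, so that the centred and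
  the shifted case share the expansion of the density and the bookkeeping of constants.\<close>

lemma (in prob_space) absolute_moment_sum_AL:
  fixes V :: "nat \<Rightarrow> real"
  assumes ab: "\<bar>\<beta>\<bar> < \<alpha>"
    and S: "distributed M lborel S (\<lambda>x. ennreal (AL_sum_density \<alpha> \<beta> \<mu> m x))"
    and l: "l = real (m + 1) * \<mu>"
    and V: "\<And>i. has_bochner_integral lborel
      (\<lambda>x. \<bar>x\<bar> powr r * (exp (\<beta> * (x - l) - \<alpha> * \<bar>x - l\<bar>) * (\<alpha> * \<bar>x - l\<bar>) ^ i))
      (V i / \<alpha> powr (r + 1))"
  shows "integrable M (\<lambda>\<omega>. \<bar>S \<omega>\<bar> powr r)"
    and "expectation (\<lambda>\<omega>. \<bar>S \<omega>\<bar> powr r) =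
      (1 - \<beta>\<^sup>2 / \<alpha>\<^sup>2) ^ (m + 1) / (2 ^ (m + 1) * fact m * \<alpha> powr r) *
      (\<Sum>j=0..m. fact (m + j) / (fact (m - j) * fact j * 2 ^ j) * V (m - j))"
proof -
  have a: "\<alpha> > 0" using ab by simp
  define K where "K = (1 - \<beta>\<^sup>2 / \<alpha>\<^sup>2) ^ (m + 1)"
  have "has_bochner_integral lborel (\<lambda>x. \<Sum>i\<le>m. K * \<alpha> * laplace_coeff m i *
      (\<bar>x\<bar> powr r * (exp (\<beta> * (x - l) - \<alpha> * \<bar>x - l\<bar>) * (\<alpha> * \<bar>x - l\<bar>) ^ i)))
    (\<Sum>i\<le>m. K * \<alpha> * laplace_coeff m i * (V i / \<alpha> powr (r + 1)))"
    by (intro has_bochner_integral_sum has_bochner_integral_mult_right V)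
  also have "(\<lambda>x. \<Sum>i\<le>m. K * \<alpha> * laplace_coeff m i *
      (\<bar>x\<bar> powr r * (exp (\<beta> * (x - l) - \<alpha> * \<bar>x - l\<bar>) * (\<alpha> * \<bar>x - l\<bar>) ^ i)))
    = (\<lambda>x. AL_sum_density \<alpha> \<beta> \<mu> m x * \<bar>x\<bar> powr r)"
  proof
    fix x
    have 1: "\<bar>\<alpha> * (x - l)\<bar> = \<alpha> * \<bar>x - l\<bar>" using a by (simp add: abs_mult)
    show "(\<Sum>i\<le>m. K * \<alpha> * laplace_coeff m i *
      (\<bar>x\<bar> powr r * (exp (\<beta> * (x - l) - \<alpha> * \<bar>x - l\<bar>) * (\<alpha> * \<bar>x - l\<bar>) ^ i)))
      = AL_sum_density \<alpha> \<beta> \<mu> m x * \<bar>x\<bar> powr r"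
      unfolding AL_sum_density_def laplace_sum_density_def poly_laplace_poly l[symmetric] 1 K_def[symmetric]
      by (simp add: sum_distrib_left sum_distrib_right exp_diff exp_minus divide_inverse mult_ac)
  qed
  \<comment> \<open>The reversal \<open>i = m - j\<close> passes from powers of the density
    polynomial to the summation index of the theorem.\<close>
  also have "(\<Sum>i\<le>m. K * \<alpha> * laplace_coeff m i * (V i / \<alpha> powr (r + 1)))
    = (\<Sum>j=0..m. K * \<alpha> * laplace_coeff m (m - j) * (V (m - j) / \<alpha> powr (r + 1)))"
    unfolding atMost_atLeast0 by (subst sum.atLeastAtMost_rev) simp
  also have "\<dots> = K / (2 ^ (m + 1) * fact m * \<alpha> powr r) *
      (\<Sum>j=0..m. fact (m + j) / (fact (m - j) * fact j * 2 ^ j) * V (m - j))"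
    unfolding sum_distrib_left
  proof (rule sum.cong)
    fix j assume "j \<in> {0..m}"
    hence j: "j \<le> m" by simp
    have "2 * m - (m - j) = m + j" "m - (m - j) = j" using j by auto
    hence "laplace_coeff m (m - j) = fact (m + j) / (fact (m - j) * fact j * 2 ^ j) / (2 ^ (m + 1) * fact m)"
      by (simp add: laplace_coeff_def)
    moreover have "\<alpha> / \<alpha> powr (r + 1) = 1 / \<alpha> powr r" using a by (simp add: powr_add)
    moreover have "K * \<alpha> * laplace_coeff m (m - j) * (V (m - j) / \<alpha> powr (r + 1))
      = K * laplace_coeff m (m - j) * V (m - j) * (\<alpha> / \<alpha> powr (r + 1))" by simp
    ultimately show "K * \<alpha> * laplace_coeff m (m - j) * (V (m - j) / \<alpha> powr (r + 1))
      = K / (2 ^ (m + 1) * fact m * \<alpha> powr r) * (fact (m + j) / (fact (m - j) * fact j * 2 ^ j) * V (m - j))"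
      by (simp add: mult_ac)
  qed simp
  finally have *: "has_bochner_integral lborel (\<lambda>x. AL_sum_density \<alpha> \<beta> \<mu> m x * \<bar>x\<bar> powr r)
    (K / (2 ^ (m + 1) * fact m * \<alpha> powr r) *
      (\<Sum>j=0..m. fact (m + j) / (fact (m - j) * fact j * 2 ^ j) * V (m - j)))" .
  show "integrable M (\<lambda>\<omega>. \<bar>S \<omega>\<bar> powr r)"
    using * distributed_integrable[OF S, of "\<lambda>x. \<bar>x\<bar> powr r"] AL_sum_density_nonneg[OF ab]
    by (simp add: has_bochner_integral_iff)
  show "expectation (\<lambda>\<omega>. \<bar>S \<omega>\<bar> powr r) =
      (1 - \<beta>\<^sup>2 / \<alpha>\<^sup>2) ^ (m + 1) / (2 ^ (m + 1) * fact m * \<alpha> powr r) *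
      (\<Sum>j=0..m. fact (m + j) / (fact (m - j) * fact j * 2 ^ j) * V (m - j))"
    using * distributed_integral[OF S, of "\<lambda>x. \<bar>x\<bar> powr r"] AL_sum_density_nonneg[OF ab]
    by (simp add: has_bochner_integral_iff K_def)
qed

text \<open>Integrability is asserted along with the formulas, because the expectation of a
  non-integrable function is 0 by convention and an equation alone would not express
  finiteness.\<close>

theorem mainTheorem9:
  fixes M :: "'a measure" and X :: "nat \<Rightarrow> 'a \<Rightarrow> real" and S :: "'a \<Rightarrow> real"
    and \<alpha> \<beta> \<mu> lam r :: real and n m :: nat
  assumes "prob_space M"
    and "0 \<le> \<bar>\<beta>\<bar>" and "\<bar>\<beta>\<bar> < \<alpha>"
    and "n \<ge> 1"
    and "prob_space.indep_vars M (\<lambda>_. borel) X {1..n}"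
    and "\<And>i. i \<in> {1..n} \<Longrightarrow> distributed M lborel (X i) (\<lambda>x. ennreal (AL_density \<alpha> \<beta> \<mu> x))"
    and "S = (\<lambda>\<omega>. \<Sum>i\<in>{1..n}. X i \<omega>)"
    and "m = n - 1" and "lam = real n * \<mu>"
    and "r > -1"
  shows "integrable M (\<lambda>\<omega>. \<bar>S \<omega>\<bar> powr r) \<and>
    (\<mu> \<noteq> 0 \<longrightarrow>
      prob_space.expectation M (\<lambda>\<omega>. \<bar>S \<omega>\<bar> powr r) =
        (1 - \<beta>\<^sup>2 / \<alpha>\<^sup>2) ^ (m + 1) / (2 ^ (m + 1) * fact m * \<alpha> powr r) *
        (\<Sum>j=0..m. fact (m + j) / (fact (m - j) * fact j * 2 ^ j) *
          (exp (- \<alpha> * \<bar>lam\<bar> - \<beta> * lam) * Gamma (r + 1)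
             / (1 + sgn lam * \<beta> / \<alpha>) powr (r + real m - real j + 1)
             * tricomi_U (real j - real m) (real j - real m - r) (\<alpha> * \<bar>lam\<bar> + \<beta> * lam)
           + (\<alpha> * \<bar>lam\<bar>) powr (r + real m - real j + 1)
             * Beta (r + 1) (real m - real j + 1)
             * kummer_M (real m - real j + 1) (r + real m - real j + 2) (- \<alpha> * \<bar>lam\<bar> - \<beta> * lam)
           + (\<alpha> * \<bar>lam\<bar>) powr (r + real m - real j + 1)
             * fact (m - j)
             * tricomi_U (real m - real j + 1) (r + real m - real j + 2) (\<alpha> * \<bar>lam\<bar> - \<beta> * lam)))) \<and>
    (\<mu> = 0 \<longrightarrow>
      prob_space.expectation M (\<lambda>\<omega>. \<bar>S \<omega>\<bar> powr r) =
        (1 - \<beta>\<^sup>2 / \<alpha>\<^sup>2) ^ (m + 1) / (2 ^ (m + 1) * fact m * \<alpha> powr r) *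
        (\<Sum>j=0..m. fact (m + j) / (fact (m - j) * fact j * 2 ^ j) *
          (Gamma (r + real m - real j + 1) / (1 + \<beta> / \<alpha>) powr (r + real m - real j + 1)
           + Gamma (r + real m - real j + 1) / (1 - \<beta> / \<alpha>) powr (r + real m - real j + 1))))"
proof -
  interpret prob_space M by fact
  have ab: "\<bar>\<beta>\<bar> < \<alpha>" and r: "r > -1" by fact+
  have lam: "lam = real (m + 1) * \<mu>" using assms(4,8,9) by simp
  have card: "card {1..n} - 1 = m" using assms(8) by simp
  have S: "distributed M lborel S (\<lambda>x. ennreal (AL_sum_density \<alpha> \<beta> \<mu> m x))"
    using distributed_sum_AL[OF ab _ _ assms(5) assms(6)] assms(4) unfolding assms(7) card by auto
  note moment = absolute_moment_sum_AL[OF ab S lam]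
  show ?thesis
  proof (cases "\<mu> = 0")
    case True
    have "lam = 0" using True lam by simp
    define V where "V = (\<lambda>i. Gamma (r + real i + 1) / (1 + \<beta> / \<alpha>) powr (r + real i + 1)
      + Gamma (r + real i + 1) / (1 - \<beta> / \<alpha>) powr (r + real i + 1))"
    have V: "has_bochner_integral lborel
      (\<lambda>x. \<bar>x\<bar> powr r * (exp (\<beta> * (x - lam) - \<alpha> * \<bar>x - lam\<bar>) * (\<alpha> * \<bar>x - lam\<bar>) ^ i))
      (V i / \<alpha> powr (r + 1))" for i
      using has_bochner_integral_centred_moment[OF ab r, of i] by (simp add: V_def \<open>lam = 0\<close>)
    \<comment> \<open>\<open>real (m - j) = real m - real j\<close> needs \<open>j \<le> m\<close>,
      so this rewriting is valid only within the range of summation and is applied through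
      \<open>sum.cong\<close>.\<close>
    have VV: "V (m - j) = Gamma (r + real m - real j + 1) / (1 + \<beta> / \<alpha>) powr (r + real m - real j + 1)
      + Gamma (r + real m - real j + 1) / (1 - \<beta> / \<alpha>) powr (r + real m - real j + 1)"
      if "j \<in> {0..m}" for j
      using that by (simp add: V_def of_nat_diff add_diff_eq)
    note moment[OF V]
    with True show ?thesis by (simp only: VV cong: sum.cong) simp
  next
    case False
    have "lam \<noteq> 0" using False lam by simp
    define V where "V = (\<lambda>i. exp (- (\<alpha> * \<bar>lam\<bar> + \<beta> * lam)) * Gamma (r + 1)
        / (1 + sgn lam * \<beta> / \<alpha>) powr (r + real i + 1)
        * tricomi_U (- real i) (- real i - r) (\<alpha> * \<bar>lam\<bar> + \<beta> * lam)
      + (\<alpha> * \<bar>lam\<bar>) powr (r + real i + 1) * Beta (r + 1) (real i + 1)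
        * kummer_M (real i + 1) (r + real i + 2) (- (\<alpha> * \<bar>lam\<bar> + \<beta> * lam))
      + (\<alpha> * \<bar>lam\<bar>) powr (r + real i + 1) * fact i
        * tricomi_U (real i + 1) (r + real i + 2) (\<alpha> * \<bar>lam\<bar> - \<beta> * lam))"
    have V: "has_bochner_integral lborel
      (\<lambda>x. \<bar>x\<bar> powr r * (exp (\<beta> * (x - lam) - \<alpha> * \<bar>x - lam\<bar>) * (\<alpha> * \<bar>x - lam\<bar>) ^ i))
      (V i / \<alpha> powr (r + 1))" for i
      unfolding V_def by (rule has_bochner_integral_shifted_moment[OF ab \<open>lam \<noteq> 0\<close> r])
    have VV: "V (m - j) = exp (- \<alpha> * \<bar>lam\<bar> - \<beta> * lam) * Gamma (r + 1)
             / (1 + sgn lam * \<beta> / \<alpha>) powr (r + real m - real j + 1)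
             * tricomi_U (real j - real m) (real j - real m - r) (\<alpha> * \<bar>lam\<bar> + \<beta> * lam)
           + (\<alpha> * \<bar>lam\<bar>) powr (r + real m - real j + 1)
             * Beta (r + 1) (real m - real j + 1)
             * kummer_M (real m - real j + 1) (r + real m - real j + 2) (- \<alpha> * \<bar>lam\<bar> - \<beta> * lam)
           + (\<alpha> * \<bar>lam\<bar>) powr (r + real m - real j + 1)
             * fact (m - j)
             * tricomi_U (real m - real j + 1) (r + real m - real j + 2) (\<alpha> * \<bar>lam\<bar> - \<beta> * lam)"
      if "j \<in> {0..m}" for j
    proof -
      have eqs: "real (m - j) = real m - real j" "r + (real m - real j) = r + real m - real j"
        "- (real m - real j) = real j - real m"
        "- (\<alpha> * \<bar>lam\<bar> + \<beta> * lam) = - \<alpha> * \<bar>lam\<bar> - \<beta> * lam"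
        using that by (simp_all add: of_nat_diff)
      show ?thesis unfolding V_def eqs ..
    qed
    note moment[OF V]
    with False show ?thesis by (simp only: VV cong: sum.cong) simp
  qed
qed

end
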